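(* Fix $\varepsilon\in(0,\varepsilon_{\max})$, write $\Omega=\Omega_\varepsilon$, let $f$ satisfy the regularity condition stated in the context, and let $v\in\mathbb R$. Let $B$ be the standard candidate on $\Omega_R(-\infty,v)$. Then for every point $x\in\Omega_R(-\infty,v)$ there exists a sequence of non-decreasing test functions $\varphi_{n,x}$ which is an optimizing sequence for $B$ at $x$; moreover $\varphi_{n,x}\preceq g(v)$ pointwise. (The decay condition $(1+|w_R-g|)\exp(-\int_t^{t_0}\lambda_R)\to0$ as $t\to-\infty$ is not assumed.)
   Context: Domains. Let $0<\varepsilon_{\max}\le\infty$ and let $\mathbf g(\cdot;\varepsilon)=(\mathbf g_1,\mathbf g_2):\mathbb R\to\mathbb R^2$, $0\le\varepsilon<\varepsilon_{\max}$, be $C^3$ curves, $C^{3,1}$-smooth in $(t,\varepsilon)$ (the mixed derivative $\partial_t^3\partial_\varepsilon\mathbf g$ is continuous), such that for every $\varepsilon$ (primes denote $\partial_t$) $\mathbf g_1'>0$ and $\mathbf g_2''\mathbf g_1'-\mathbf g_2'\mathbf g_1''>0$. Put $g(t)=(g_1(t),g_2(t))=\mathbf g(t;0)$ and $\Xi_\varepsilon=\{(\mathbf g_1(t;\varepsilon),x_2):t\in\mathbb R,\ x_2>\mathbf g_2(t;\varepsilon)\}$. Assume that for $\varepsilon_1<\varepsilon_2$ one has $\Xi_{\varepsilon_1}\supset\Xi_{\varepsilon_2}$ and $\mathbf g(t;\varepsilon_1)\notin\overline{\Xi_{\varepsilon_2}}$ for all $t$. Assume that for every $\varepsilon\in(0,\varepsilon_{\max})$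 and $t\in\mathbb R$ there are two tangent lines from $g(t)$ to $\Xi_\varepsilon$, each meeting the curve $g(\cdot)$ twice. Let $w_L(t;\varepsilon)=\mathbf g(s_L;\varepsilon)$ and $w_R(t;\varepsilon)=\mathbf g(s_R;\varepsilon)$, $s_R<s_L$, be the tangency points, $S_L(t;\varepsilon)=[g(t),w_L(t;\varepsilon)]$, $S_R(t;\varepsilon)=[g(t),w_R(t;\varepsilon)]$ the tangent segments, and $\kappa_L,\kappa_R$ their slopes; assume $\partial_\varepsilon\kappa_L\ne0$, $\partial_\varepsilon\kappa_R\neq 0$ everywhere. Let $T_\varepsilon(t)$ be the closed curvilinear triangle with vertex $g(t)$ bounded by $S_L(t;\varepsilon)$, $S_R(t;\varepsilon)$ and the arc of $\mathbf g(\cdot;\varepsilon)$ between the two tangency points, and $\Omega_\varepsilon=\bigcup_{t}T_\varepsilon(t)$. The fixed boundary is $\partial_{\rm fixed}\Omega_\varepsilon=g(\mathbb R)$. The scalar function $\lambda_R>0$ is defined by $\lambda_R(t)(g(t)-w_R(t))=w_R'(t)$. Put $\kappa_2=g_2'/g_1'$, $\kappa_3=f'/g_1'$, $\mathfrak K=\kappa_3'/\kappa_2'$. Regularity condition on $f:\mathbb R\to\mathbb R$: $f\in C^2(\mathbb R)$ and $\mathfrak K$ is piecewise monotone with finitely many monotonicity intervals. Standard candidate on $\Omega_R(-\infty,v)=\bigcup_{t<v}S_R(t)$: with $\kappa=\kappa_R$, it is $B(x)=f(t)+(x_1-g_1(t))[\kappa_3(t)+(\kappa(t)-\kappa_2(t))\beta_2(t)]$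 for $x\in S_R(t)$, where $\beta_2(t)=\mathfrak K(t)-\int_{-\infty}^t\exp\big(-\int_\tau^t\frac{\kappa_2'}{\kappa_2-\kappa}\big)d\mathfrak K(\tau)$ is required to be finite and to satisfy $\beta_2'(t)=\frac{\kappa_2'(t)}{\kappa_2(t)-\kappa(t)}\int_{-\infty}^t\exp\big(-\int_\tau^t\frac{\kappa_2'}{\kappa_2-\kappa}\big)d\mathfrak K(\tau)<0$ for $t<v$. For an interval $I$, $\mathbf A_\Omega(I)$ is the class of summable $\varphi:I\to\partial_{\rm fixed}\Omega$ with average $\langle\varphi\rangle_J\in\Omega$ for every subinterval $J\subset I$. A test function for $x$ is $\varphi\in\mathbf A_\Omega(I)$ with $\langle\varphi\rangle_I=x$. With $\mathrm f(g(t))=f(t)$, an optimizing sequence for $B$ at $x$ is a sequence of test functions $\varphi_n$ for $x$ with $B(x)=\lim_n\langle \mathrm f(\varphi_n)\rangle_I$. On $\partial_{\rm fixed}\Omega$ one writes $g(t)\preceq g(s)$ if $t\le s$; monotonicity of $\varphi$ is with respect to $\preceq$. *)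

theory Defs
  imports "HOL-Analysis.Analysis"
begin

section \<open>Families of curves and the domains they bound\<close>

text \<open>
  A family of curves is a function \<open>G\<close> whose first argument is the parameter \<open>\<epsilon>\<close> and whose
  second argument is the curve parameter \<open>t\<close>, so that \<open>G \<epsilon>\<close> is a planar curve and \<open>G 0\<close> is the
  curve \<open>g\<close>.  The parameter set is \<open>[0, \<epsilon>max)\<close>, where \<open>\<epsilon>max\<close> may be infinite.
\<close>

definition params :: "ereal \<Rightarrow> real set" where
  "params \<epsilon>max = {\<epsilon>. 0 \<le> \<epsilon> \<and> ereal \<epsilon> < \<epsilon>max}"

text \<open>
  \<open>D i j\<close> is the partial derivative of order \<open>i\<close> in \<open>t\<close> and order \<open>j\<close> in \<open>\<epsilon>\<close>; at \<open>\<epsilon> = 0\<close> the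
  derivative in \<open>\<epsilon>\<close> is one-sided.
\<close>

definition C31_family :: "ereal \<Rightarrow> (real \<Rightarrow> real \<Rightarrow> real \<times> real) \<Rightarrow> bool" where
  "C31_family \<epsilon>max G \<longleftrightarrow>
     (\<exists>D :: nat \<Rightarrow> nat \<Rightarrow> real \<Rightarrow> real \<Rightarrow> real \<times> real.
        (\<forall>\<epsilon>\<in>params \<epsilon>max. \<forall>t. D 0 0 \<epsilon> t = G \<epsilon> t) \<and>
        (\<forall>i<3. \<forall>j\<le>1. \<forall>\<epsilon>\<in>params \<epsilon>max. \<forall>t.
           (D i j \<epsilon> has_vector_derivative D (Suc i) j \<epsilon> t) (at t)) \<and>
        (\<forall>i\<le>3. \<forall>\<epsilon>\<in>params \<epsilon>max. \<forall>t.
           ((\<lambda>e. D i 0 e t) has_vector_derivative D i 1 \<epsilon> t) (at \<epsilon> within params \<epsilon>max)) \<and>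
        (\<forall>i\<le>3. \<forall>j\<le>1. continuous_on (params \<epsilon>max \<times> UNIV) (\<lambda>(\<epsilon>, t). D i j \<epsilon> t)))"

definition convex_curve :: "(real \<Rightarrow> real \<times> real) \<Rightarrow> bool" where
  "convex_curve \<gamma> \<longleftrightarrow>
     (let \<gamma>1 = (\<lambda>t. fst (\<gamma> t)); \<gamma>2 = (\<lambda>t. snd (\<gamma> t)) in
      \<forall>t. deriv \<gamma>1 t > 0 \<and>
          deriv (deriv \<gamma>2) t * deriv \<gamma>1 t - deriv \<gamma>2 t * deriv (deriv \<gamma>1) t > 0)"

definition Xi :: "(real \<Rightarrow> real \<Rightarrow> real \<times> real) \<Rightarrow> real \<Rightarrow> (real \<times> real) set" where
  "Xi G \<epsilon> = {(fst (G \<epsilon> t), x2) | t x2. x2 > snd (G \<epsilon> t)}"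

definition tangent_line :: "(real \<Rightarrow> real \<times> real) \<Rightarrow> real \<Rightarrow> (real \<times> real) set" where
  "tangent_line \<gamma> s = range (\<lambda>u::real. \<gamma> s + u *\<^sub>R vector_derivative \<gamma> (at s))"

text \<open>
  The curves \<open>G \<epsilon>\<close> are strictly convex, so the tangent lines from \<open>G 0 t\<close> to \<open>Xi G \<epsilon>\<close>
  correspond one to one to their tangency parameters.
\<close>

definition tangency_params :: "(real \<Rightarrow> real \<Rightarrow> real \<times> real) \<Rightarrow> real \<Rightarrow> real \<Rightarrow> real set" where
  "tangency_params G \<epsilon> t = {s. G 0 t \<in> tangent_line (G \<epsilon>) s}"

definition w_R :: "(real \<Rightarrow> real \<Rightarrow> real \<times> real) \<Rightarrow> real \<Rightarrow> real \<Rightarrow> real \<times> real" where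
  "w_R G \<epsilon> t = G \<epsilon> (Min (tangency_params G \<epsilon> t))"

definition w_L :: "(real \<Rightarrow> real \<Rightarrow> real \<times> real) \<Rightarrow> real \<Rightarrow> real \<Rightarrow> real \<times> real" where
  "w_L G \<epsilon> t = G \<epsilon> (Max (tangency_params G \<epsilon> t))"

definition S_R :: "(real \<Rightarrow> real \<Rightarrow> real \<times> real) \<Rightarrow> real \<Rightarrow> real \<Rightarrow> (real \<times> real) set" where
  "S_R G \<epsilon> t = closed_segment (G 0 t) (w_R G \<epsilon> t)"

definition S_L :: "(real \<Rightarrow> real \<Rightarrow> real \<times> real) \<Rightarrow> real \<Rightarrow> real \<Rightarrow> (real \<times> real) set" where
  "S_L G \<epsilon> t = closed_segment (G 0 t) (w_L G \<epsilon> t)"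

definition slope :: "real \<times> real \<Rightarrow> real \<times> real \<Rightarrow> real" where
  "slope p q = (snd q - snd p) / (fst q - fst p)"

definition kappa_R :: "(real \<Rightarrow> real \<Rightarrow> real \<times> real) \<Rightarrow> real \<Rightarrow> real \<Rightarrow> real" where
  "kappa_R G \<epsilon> t = slope (G 0 t) (w_R G \<epsilon> t)"

definition kappa_L :: "(real \<Rightarrow> real \<Rightarrow> real \<times> real) \<Rightarrow> real \<Rightarrow> real \<Rightarrow> real" where
  "kappa_L G \<epsilon> t = slope (G 0 t) (w_L G \<epsilon> t)"

definition admissible_family :: "ereal \<Rightarrow> (real \<Rightarrow> real \<Rightarrow> real \<times> real) \<Rightarrow> bool" where
  "admissible_family \<epsilon>max G \<longleftrightarrow>
     0 < \<epsilon>max \<and>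
     C31_family \<epsilon>max G \<and>
     (\<forall>\<epsilon>\<in>params \<epsilon>max. convex_curve (G \<epsilon>)) \<and>
     (\<forall>\<epsilon>1\<in>params \<epsilon>max. \<forall>\<epsilon>2\<in>params \<epsilon>max. \<epsilon>1 < \<epsilon>2 \<longrightarrow>
        Xi G \<epsilon>2 \<subseteq> Xi G \<epsilon>1 \<and> (\<forall>t. G \<epsilon>1 t \<notin> closure (Xi G \<epsilon>2))) \<and>
     (\<forall>\<epsilon>\<in>params \<epsilon>max. 0 < \<epsilon> \<longrightarrow> (\<forall>t.
        card (tangency_params G \<epsilon> t) = 2 \<and>
        (\<forall>s\<in>tangency_params G \<epsilon> t. card (tangent_line (G \<epsilon>) s \<inter> range (G 0)) = 2) \<and>
        (\<exists>d. ((\<lambda>e. kappa_L G e t) has_real_derivative d) (at \<epsilon>) \<and> d \<noteq> 0) \<and>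
        (\<exists>d. ((\<lambda>e. kappa_R G e t) has_real_derivative d) (at \<epsilon>) \<and> d \<noteq> 0)))"

definition triangle_boundary ::
  "(real \<Rightarrow> real \<Rightarrow> real \<times> real) \<Rightarrow> real \<Rightarrow> real \<Rightarrow> (real \<times> real) set" where
  "triangle_boundary G \<epsilon> t =
     S_L G \<epsilon> t \<union> S_R G \<epsilon> t \<union>
     G \<epsilon> ` {Min (tangency_params G \<epsilon> t)..Max (tangency_params G \<epsilon> t)}"

definition curvilinear_triangle ::
  "(real \<Rightarrow> real \<Rightarrow> real \<times> real) \<Rightarrow> real \<Rightarrow> real \<Rightarrow> (real \<times> real) set" where
  "curvilinear_triangle G \<epsilon> t = triangle_boundary G \<epsilon> t \<union> inside (triangle_boundary G \<epsilon> t)"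

definition Omega :: "(real \<Rightarrow> real \<Rightarrow> real \<times> real) \<Rightarrow> real \<Rightarrow> (real \<times> real) set" where
  "Omega G \<epsilon> = (\<Union>t. curvilinear_triangle G \<epsilon> t)"

definition Omega_R :: "(real \<Rightarrow> real \<Rightarrow> real \<times> real) \<Rightarrow> real \<Rightarrow> real \<Rightarrow> (real \<times> real) set" where
  "Omega_R G \<epsilon> v = (\<Union>t\<in>{..<v}. S_R G \<epsilon> t)"


section \<open>Regularity of the boundary data\<close>

definition kappa2 :: "(real \<Rightarrow> real \<times> real) \<Rightarrow> real \<Rightarrow> real" where
  "kappa2 g t = deriv (\<lambda>s. snd (g s)) t / deriv (\<lambda>s. fst (g s)) t"

definition kappa3 :: "(real \<Rightarrow> real \<times> real) \<Rightarrow> (real \<Rightarrow> real) \<Rightarrow> real \<Rightarrow> real" where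
  "kappa3 g f t = deriv f t / deriv (\<lambda>s. fst (g s)) t"

definition frak_K :: "(real \<Rightarrow> real \<times> real) \<Rightarrow> (real \<Rightarrow> real) \<Rightarrow> real \<Rightarrow> real" where
  "frak_K g f t = deriv (kappa3 g f) t / deriv (kappa2 g) t"

definition C2_function :: "(real \<Rightarrow> real) \<Rightarrow> bool" where
  "C2_function f \<longleftrightarrow>
     (\<exists>f' f''. (\<forall>t. (f has_real_derivative f' t) (at t)) \<and>
               (\<forall>t. (f' has_real_derivative f'' t) (at t)) \<and>
               continuous_on UNIV f'')"

definition piecewise_monotone :: "(real \<Rightarrow> real) \<Rightarrow> bool" where
  "piecewise_monotone K \<longleftrightarrow>
     (\<exists>\<I>. finite \<I> \<and> \<Union>\<I> = UNIV \<and>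
          (\<forall>J\<in>\<I>. is_interval J \<and> (mono_on J K \<or> antimono_on J K)))"

definition regular_data :: "(real \<Rightarrow> real \<times> real) \<Rightarrow> (real \<Rightarrow> real) \<Rightarrow> bool" where
  "regular_data g f \<longleftrightarrow> C2_function f \<and> piecewise_monotone (frak_K g f)"


section \<open>The standard candidate on a tangent domain\<close>

text \<open>
  Lebesgue--Stieltjes integral of \<open>h\<close> over \<open>A\<close> against a function \<open>K\<close> of locally bounded
  variation: \<open>K\<close> is split into nondecreasing right-continuous parts \<open>P - N\<close>, and \<open>h\<close> has to be
  integrable against both Stieltjes measures.  The value does not depend on the splitting, since
  \<open>P - N = P' - N'\<close> makes the Stieltjes measures of \<open>P + N'\<close> and \<open>P' + N\<close> coincide.
\<close>

definition has_stieltjes_integral ::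
  "(real \<Rightarrow> real) \<Rightarrow> (real \<Rightarrow> real) \<Rightarrow> real set \<Rightarrow> real \<Rightarrow> bool" where
  "has_stieltjes_integral h K A y \<longleftrightarrow>
     (\<exists>P N. mono P \<and> mono N \<and>
            (\<forall>a. continuous (at_right a) P) \<and> (\<forall>a. continuous (at_right a) N) \<and>
            (\<forall>a. K a = P a - N a) \<and>
            set_integrable (interval_measure P) A h \<and>
            set_integrable (interval_measure N) A h \<and>
            y = (LINT \<tau>:A|interval_measure P. h \<tau>) - (LINT \<tau>:A|interval_measure N. h \<tau>))"

definition stieltjes_integrable :: "(real \<Rightarrow> real) \<Rightarrow> (real \<Rightarrow> real) \<Rightarrow> real set \<Rightarrow> bool" where
  "stieltjes_integrable h K A \<longleftrightarrow> (\<exists>y. has_stieltjes_integral h K A y)"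

definition stieltjes_integral :: "(real \<Rightarrow> real) \<Rightarrow> (real \<Rightarrow> real) \<Rightarrow> real set \<Rightarrow> real" where
  "stieltjes_integral h K A = (SOME y. has_stieltjes_integral h K A y)"

definition rate_R :: "(real \<Rightarrow> real \<Rightarrow> real \<times> real) \<Rightarrow> real \<Rightarrow> real \<Rightarrow> real" where
  "rate_R G \<epsilon> t = deriv (kappa2 (G 0)) t / (kappa2 (G 0) t - kappa_R G \<epsilon> t)"

definition weight_R :: "(real \<Rightarrow> real \<Rightarrow> real \<times> real) \<Rightarrow> real \<Rightarrow> real \<Rightarrow> real \<Rightarrow> real" where
  "weight_R G \<epsilon> t \<tau> = exp (- integral {\<tau>..t} (rate_R G \<epsilon>))"

definition memory_R ::
  "(real \<Rightarrow> real \<Rightarrow> real \<times> real) \<Rightarrow> real \<Rightarrow> (real \<Rightarrow> real) \<Rightarrow> real \<Rightarrow> real" where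
  "memory_R G \<epsilon> f t = stieltjes_integral (weight_R G \<epsilon> t) (frak_K (G 0) f) {..t}"

definition beta2 ::
  "(real \<Rightarrow> real \<Rightarrow> real \<times> real) \<Rightarrow> real \<Rightarrow> (real \<Rightarrow> real) \<Rightarrow> real \<Rightarrow> real" where
  "beta2 G \<epsilon> f t = frak_K (G 0) f t - memory_R G \<epsilon> f t"

text \<open>
  The segments \<open>S_R G \<epsilon> t\<close> are pairwise disjoint, so the last condition determines \<open>B\<close> on
  \<open>Omega_R G \<epsilon> v\<close>; the values of \<open>B\<close> elsewhere are irrelevant.
\<close>

definition standard_candidate_R ::
  "(real \<Rightarrow> real \<Rightarrow> real \<times> real) \<Rightarrow> real \<Rightarrow> (real \<Rightarrow> real) \<Rightarrow> real \<Rightarrow> (real \<times> real \<Rightarrow> real) \<Rightarrow> bool"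
  where
  "standard_candidate_R G \<epsilon> f v B \<longleftrightarrow>
     (\<forall>t<v. stieltjes_integrable (weight_R G \<epsilon> t) (frak_K (G 0) f) {..t} \<and>
            (beta2 G \<epsilon> f has_real_derivative rate_R G \<epsilon> t * memory_R G \<epsilon> f t) (at t) \<and>
            rate_R G \<epsilon> t * memory_R G \<epsilon> f t < 0) \<and>
     (\<forall>t<v. \<forall>x\<in>S_R G \<epsilon> t.
        B x = f t + (fst x - fst (G 0 t)) *
                (kappa3 (G 0) f t + (kappa_R G \<epsilon> t - kappa2 (G 0) t) * beta2 G \<epsilon> f t))"


section \<open>Test functions and optimizing sequences\<close>

definition nondegenerate_interval :: "real set \<Rightarrow> bool" where
  "nondegenerate_interval J \<longleftrightarrow> is_interval J \<and> bounded J \<and> interior J \<noteq> {}"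

definition average :: "real set \<Rightarrow> (real \<Rightarrow> 'a::euclidean_space) \<Rightarrow> 'a" where
  "average J \<phi> = (1 / measure lebesgue J) *\<^sub>R (LINT s:J|lebesgue. \<phi> s)"

text \<open>
  In what follows \<open>g\<close> parametrizes the fixed boundary of \<open>\<Omega>\<close>; functions on an interval \<open>I\<close> are
  total functions of which only the values on \<open>I\<close> matter.
\<close>

definition class_A ::
  "(real \<Rightarrow> real \<times> real) \<Rightarrow> (real \<times> real) set \<Rightarrow> real set \<Rightarrow> (real \<Rightarrow> real \<times> real) set" where
  "class_A g \<Omega> I =
     {\<phi>. \<phi> ` I \<subseteq> range g \<and> set_integrable lebesgue I \<phi> \<and>
         (\<forall>J. nondegenerate_interval J \<and> J \<subseteq> I \<longrightarrow> average J \<phi> \<in> \<Omega>)}"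

definition test_function ::
  "(real \<Rightarrow> real \<times> real) \<Rightarrow> (real \<times> real) set \<Rightarrow> real set \<Rightarrow> real \<times> real \<Rightarrow>
     (real \<Rightarrow> real \<times> real) \<Rightarrow> bool" where
  "test_function g \<Omega> I x \<phi> \<longleftrightarrow> \<phi> \<in> class_A g \<Omega> I \<and> average I \<phi> = x"

text \<open>The function on the curve with value \<open>f t\<close> at \<open>g t\<close>, for injective \<open>g\<close>.\<close>

definition on_curve :: "(real \<Rightarrow> real \<times> real) \<Rightarrow> (real \<Rightarrow> real) \<Rightarrow> real \<times> real \<Rightarrow> real" where
  "on_curve g f y = f (inv g y)"

text \<open>Integrability of the composition is required because the Bochner integral is zero otherwise.\<close>

definition optimizing_sequence ::
  "(real \<Rightarrow> real \<times> real) \<Rightarrow> (real \<times> real) set \<Rightarrow> (real \<Rightarrow> real) \<Rightarrow> real set \<Rightarrow>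
     (real \<times> real \<Rightarrow> real) \<Rightarrow> real \<times> real \<Rightarrow> (nat \<Rightarrow> real \<Rightarrow> real \<times> real) \<Rightarrow> bool" where
  "optimizing_sequence g \<Omega> f I B x \<phi> \<longleftrightarrow>
     (\<forall>n. test_function g \<Omega> I x (\<phi> n) \<and>
          set_integrable lebesgue I (\<lambda>s. on_curve g f (\<phi> n s))) \<and>
     (\<lambda>n. average I (\<lambda>s. on_curve g f (\<phi> n s))) \<longlonglongrightarrow> B x"

definition curve_le :: "(real \<Rightarrow> real \<times> real) \<Rightarrow> real \<times> real \<Rightarrow> real \<times> real \<Rightarrow> bool" where
  "curve_le g p q \<longleftrightarrow> (\<exists>t s. p = g t \<and> q = g s \<and> t \<le> s)"

definition nondecreasing_along ::
  "(real \<Rightarrow> real \<times> real) \<Rightarrow> real set \<Rightarrow> (real \<Rightarrow> real \<times> real) \<Rightarrow> bool" where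
  "nondecreasing_along g I \<phi> \<longleftrightarrow> (\<forall>r\<in>I. \<forall>s\<in>I. r \<le> s \<longrightarrow> curve_le g (\<phi> r) (\<phi> s))"

end

theory Submission
  imports Defs
begin

text \<open>
  Write \<open>w(t)\<close> for the tangency point of the right tangent from \<open>g(t)\<close> and \<open>\<kappa>(t)\<close> for its slope.
  As \<open>t\<close> grows, \<open>w\<close> runs along the upper boundary towards \<open>g(t)\<close>: \<open>w' = \<lambda> (g - w)\<close> with \<open>\<lambda> > 0\<close>.
  Put \<open>N(t) = C exp(\<integral>\<lambda>)\<close> and let \<open>\<theta>\<close> be the inverse function of \<open>N\<close>.  Then \<open>s w(\<theta>(s))\<close> has the
  derivative \<open>g(\<theta>(s))\<close>, so the nondecreasing function \<open>g \<circ> \<theta>\<close> carries the average over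
  \<open>(0, s)\<close> along the upper boundary.  The equation \<open>\<beta>\<^sub>2' = \<rho> (K - \<beta>\<^sub>2)\<close>, with
  \<open>\<rho> = \<kappa>\<^sub>2' / (\<kappa>\<^sub>2 - \<kappa>)\<close>, makes the candidate along \<open>w\<close>
  obey the same law \<open>b' = \<lambda> (f - b)\<close>, so the averages of \<open>f \<circ> \<theta>\<close> follow the candidate.  A constant
  piece \<open>g(t\<^sub>0)\<close> at the end moves the average from \<open>w(t\<^sub>0)\<close> to any point of the segment
  \<open>S_R(t\<^sub>0)\<close>.

  The path must be started at a finite time \<open>t\<^sub>1\<close>.  The tangent at \<open>w(t\<^sub>1)\<close> meets \<open>g\<close> in
  \<open>g(t\<^sub>1)\<close> and in a point \<open>g(a)\<close> to the left of \<open>w(t\<^sub>1)\<close>; a step function with these two values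
  has the average \<open>w(t\<^sub>1)\<close>.  The only error is the difference of the candidate and the chord
  average of \<open>f\<close> at \<open>w(t\<^sub>1)\<close>, weighted with \<open>exp(\<integral>\<lambda>)\<close>.  Let \<open>M = K - \<beta>\<^sub>2\<close> be the memory
  integral and \<open>W = exp(\<integral>\<rho>)\<close>.  Integrating a differential identity from \<open>a\<close> to \<open>t\<^sub>1\<close> bounds the
  error by a constant times the supremum of \<open>|W M|\<close> over \<open>(-\<infinity>, t\<^sub>1]\<close> (\<open>chord_error_bound\<close>); two
  facts make this work: the tangent from any \<open>g(r)\<close> with \<open>a \<le> r \<le> t\<^sub>1\<close> passes on or above \<open>g(a)\<close>
  (\<open>tangent_above_chord_end\<close>), and \<open>exp(\<integral>(\<lambda> - \<rho>)) (g\<^sub>1 - w\<^sub>1) (\<kappa>\<^sub>2 - \<kappa>)\<close> does not depend on \<open>t\<close>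
  (\<open>conserved\<close>).  Finally \<open>W(t) M(t)\<close> is, up to a constant, the tail over \<open>(-\<infinity>, t]\<close> of one
  convergent Stieltjes integral, hence tends to 0 as \<open>t \<rightarrow> -\<infinity>\<close> (\<open>memory_decay\<close>).  Letting
  \<open>t\<^sub>1 \<rightarrow> -\<infinity>\<close> gives the optimizing sequence.

  That averages over all subintervals stay in the domain uses only monotonicity and the position of
  the averages over initial intervals.  Averages lie above \<open>g\<close> by convexity.  For an interval with
  right end \<open>d\<close>, compare with the tangent from \<open>g(\<theta>(d))\<close>: along \<open>\<theta>\<close> the curve \<open>g\<close> is first above
  it and then below it, and its average up to \<open>d\<close> is on it, so the average over any final piece is on
  or below the tangent, hence on or below the upper curve (\<open>average_between_curves\<close>).  A point
  between the two curves lies in the curvilinear triangle whose vertex is vertically below it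
  (\<open>vertical_segment_in_triangle\<close>).
\<close>

section \<open>Stieltjes integrals\<close>

text \<open>
  Both sides are measures, and they agree on the half-open intervals.
\<close>

lemma emeasure_interval_measure_add:
  fixes P Q :: "real \<Rightarrow> real"
  assumes P: "mono P" "\<And>a. continuous (at_right a) P"
    and Q: "mono Q" "\<And>a. continuous (at_right a) Q"
    and A: "A \<in> sets borel"
  shows "emeasure (interval_measure (\<lambda>x. P x + Q x)) A =
    emeasure (interval_measure P) A + emeasure (interval_measure Q) A"
proof -
  define \<mu> where "\<mu> = (\<lambda>A. emeasure (interval_measure P) A + emeasure (interval_measure Q) A)"
  define M where "M = measure_of (UNIV :: real set) (sets borel) \<mu>"
  have sets_M: "sets M = sets borel"
    unfolding M_def using sets.sigma_sets_eq[of borel] by simp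
  have "countably_additive (sets borel) \<mu>"
  proof (rule countably_additiveI)
    fix S :: "nat \<Rightarrow> real set"
    assume S: "range S \<subseteq> sets borel" "disjoint_family S"
    have "(\<Sum>i. \<mu> (S i)) = (\<Sum>i. emeasure (interval_measure P) (S i)) + (\<Sum>i. emeasure (interval_measure Q) (S i))"
      unfolding \<mu>_def by (rule suminf_add[symmetric]) auto
    then show "(\<Sum>i. \<mu> (S i)) = \<mu> (\<Union>i. S i)"
      using S by (simp add: \<mu>_def suminf_emeasure)
  qed
  then have em_M: "emeasure M B = \<mu> B" if "B \<in> sets borel" for B
    unfolding M_def
    by (intro emeasure_measure_of_sigma) (use that sets.sigma_algebra_axioms[of borel] in \<open>auto simp: positive_def \<mu>_def\<close>)
  have mono_PQ: "mono (\<lambda>x. P x + Q x)"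
    using P(1) Q(1) by (auto simp: mono_def intro: add_mono)
  have cont_PQ: "continuous (at_right a) (\<lambda>x. P x + Q x)" for a
    using P(2) Q(2) by (intro continuous_intros)
  have "M = interval_measure (\<lambda>x. P x + Q x)"
  proof (rule measure_eqI_generator_eq[where E = "range (\<lambda>(a, b). {a<..b::real})"
        and \<Omega> = UNIV and A = "\<lambda>n. {- real n<..real n}"])
    show "Int_stable (range (\<lambda>(a, b). {a<..b::real}))"
      by (auto simp: Int_stable_def)
    have borel: "sets (borel :: real measure) = sigma_sets UNIV (range (\<lambda>(a, b). {a<..b::real}))"
      by (subst borel_sigma_sets_Ioc) simp
    show "sets M = sigma_sets UNIV (range (\<lambda>(a, b). {a<..b::real}))"
      "sets (interval_measure (\<lambda>x. P x + Q x)) = sigma_sets UNIV (range (\<lambda>(a, b). {a<..b::real}))"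
      using sets_M borel by simp_all
    have *: "emeasure M {a<..b} = emeasure (interval_measure (\<lambda>x. P x + Q x)) {a<..b}" for a b
    proof (cases "a \<le> b")
      case True
      have "emeasure (interval_measure F) {a<..b} = ennreal (F b - F a)"
        if "mono F" "\<And>a. continuous (at_right a) F" for F
        using that True by (intro emeasure_interval_measure_Ioc) (auto dest: monoD)
      moreover have "ennreal (P b - P a) + ennreal (Q b - Q a) = ennreal (P b + Q b - (P a + Q a))"
        using P(1) Q(1) True
        by (subst ennreal_plus[symmetric]) (auto dest: monoD simp: algebra_simps)
      ultimately show ?thesis
        using P Q mono_PQ cont_PQ by (simp add: em_M \<mu>_def)
    next
      case False
      then show ?thesis by simp
    qed
    show "emeasure M X = emeasure (interval_measure (\<lambda>x. P x + Q x)) X"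
      if "X \<in> range (\<lambda>(a, b). {a<..b::real})" for X
      using that * by auto
    show "(\<Union>n. {- real n<..real n}) = UNIV"
    proof safe
      fix x :: real
      obtain n where "\<bar>x\<bar> < real n" using reals_Archimedean2 by blast
      then have "x \<in> {- real n<..real n}" by auto
      then show "x \<in> (\<Union>n. {- real n<..real n})" by blast
    qed auto
    show "emeasure M {- real n<..real n} \<noteq> \<infinity>" for n
      using P Q mono_PQ cont_PQ
      by (subst em_M) (auto simp: \<mu>_def emeasure_interval_measure_Ioc monoD)
  qed auto
  then show ?thesis using em_M[OF A] by (simp add: \<mu>_def)
qed

lemma nn_integral_interval_measure_add:
  fixes P Q :: "real \<Rightarrow> real"
  assumes P: "mono P" "\<And>a. continuous (at_right a) P"
    and Q: "mono Q" "\<And>a. continuous (at_right a) Q"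
    and h: "h \<in> borel_measurable borel"
  shows "(\<integral>\<^sup>+x. h x \<partial>interval_measure (\<lambda>x. P x + Q x)) =
    (\<integral>\<^sup>+x. h x \<partial>interval_measure P) + (\<integral>\<^sup>+x. h x \<partial>interval_measure Q)"
  using h
proof (induction h rule: borel_measurable_induct)
  case (cong f g)
  then show ?case by (simp cong: nn_integral_cong)
next
  case (set A)
  then show ?case by (simp add: emeasure_interval_measure_add[OF P Q])
next
  case (mult u c)
  then show ?case by (simp add: nn_integral_cmult distrib_left)
next
  case (add u v)
  then show ?case by (simp add: nn_integral_add ac_simps)
next
  case (seq U)
  have "(\<integral>\<^sup>+x. (SUP i. U i) x \<partial>interval_measure F) = (SUP i. \<integral>\<^sup>+x. U i x \<partial>interval_measure F)" for F
    unfolding SUP_apply using seq by (intro nn_integral_monotone_convergence_SUP) auto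
  moreover have "incseq (\<lambda>i. \<integral>\<^sup>+x. U i x \<partial>interval_measure F)" for F
    using seq(3) by (intro incseq_SucI nn_integral_mono) (auto simp: incseq_Suc_iff le_fun_def)
  ultimately show ?case
    using seq by (simp add: ennreal_SUP_add)
qed

text \<open>
  The integral is defined as some value obtained from some splitting of \<open>K\<close>.  To compare such values
  for different upper limits, one has to know that the splitting does not matter:
  \<open>P - N = P' - N'\<close> gives \<open>P + N' = P' + N\<close>, and the measures of these sums are sums of measures.
\<close>

lemma has_stieltjes_integral_unique:
  assumes y: "has_stieltjes_integral h K A y" and y': "has_stieltjes_integral h K A y'"
    and nonneg: "\<And>x. x \<in> A \<Longrightarrow> 0 \<le> h x"
  shows "y = y'"
proof -
  obtain P N where P: "mono P" "\<And>a. continuous (at_right a) P"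
    and N: "mono N" "\<And>a. continuous (at_right a) N"
    and K: "\<And>a. K a = P a - N a"
    and hP: "set_integrable (interval_measure P) A h" and hN: "set_integrable (interval_measure N) A h"
    and y: "y = (LINT \<tau>:A|interval_measure P. h \<tau>) - (LINT \<tau>:A|interval_measure N. h \<tau>)"
    using y unfolding has_stieltjes_integral_def by blast
  obtain P' N' where P': "mono P'" "\<And>a. continuous (at_right a) P'"
    and N': "mono N'" "\<And>a. continuous (at_right a) N'"
    and K': "\<And>a. K a = P' a - N' a"
    and hP': "set_integrable (interval_measure P') A h" and hN': "set_integrable (interval_measure N') A h"
    and y': "y' = (LINT \<tau>:A|interval_measure P'. h \<tau>) - (LINT \<tau>:A|interval_measure N'. h \<tau>)"
    using y' unfolding has_stieltjes_integral_def by blast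
  define u where "u = (\<lambda>x. indicator A x *\<^sub>R h x)"
  have u: "0 \<le> u x" for x
    using nonneg by (auto simp: u_def indicator_def)
  have nn: "(\<integral>\<^sup>+x. ennreal (u x) \<partial>interval_measure F) = ennreal (LINT \<tau>:A|interval_measure F. h \<tau>)"
    "0 \<le> (LINT \<tau>:A|interval_measure F. h \<tau>)"
    if "set_integrable (interval_measure F) A h" for F
    using that u unfolding set_integrable_def set_lebesgue_integral_def u_def[symmetric]
    by (auto intro: nn_integral_eq_integral)
  have "u \<in> borel_measurable borel"
    using hP unfolding set_integrable_def u_def[symmetric]
    by (auto dest: borel_measurable_integrable)
  then have mu: "(\<lambda>x. ennreal (u x)) \<in> borel_measurable borel" by measurable
  have "(\<lambda>x. P x + N' x) = (\<lambda>x. P' x + N x)"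
    using K K' by (auto simp: fun_eq_iff algebra_simps)
  then have "(\<integral>\<^sup>+x. ennreal (u x) \<partial>interval_measure P) + (\<integral>\<^sup>+x. ennreal (u x) \<partial>interval_measure N') =
      (\<integral>\<^sup>+x. ennreal (u x) \<partial>interval_measure P') + (\<integral>\<^sup>+x. ennreal (u x) \<partial>interval_measure N)"
    using nn_integral_interval_measure_add[OF P N' mu] nn_integral_interval_measure_add[OF P' N mu]
    by simp
  then have "(LINT \<tau>:A|interval_measure P. h \<tau>) + (LINT \<tau>:A|interval_measure N'. h \<tau>) =
      (LINT \<tau>:A|interval_measure P'. h \<tau>) + (LINT \<tau>:A|interval_measure N. h \<tau>)"
    using nn[OF hP] nn[OF hP'] nn[OF hN] nn[OF hN']
    by (simp add: ennreal_plus[symmetric] del: ennreal_plus)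
  then show ?thesis using y y' by simp
qed

lemma set_integral_atMost_tendsto_0:
  fixes h :: "real \<Rightarrow> real"
  assumes "set_integrable (interval_measure F) {..T} h"
  shows "((\<lambda>t. LINT \<tau>:{..t}|interval_measure F. h \<tau>) \<longlongrightarrow> 0) at_bot"
proof -
  have int: "integrable (interval_measure F) (\<lambda>\<tau>. indicator {..T} \<tau> *\<^sub>R h \<tau>)"
    using assms by (simp add: set_integrable_def)
  have restrict: "indicator {..min t T} \<tau> *\<^sub>R h \<tau> = indicator {..t} \<tau> *\<^sub>R (indicator {..T} \<tau> *\<^sub>R h \<tau>)"
    for t \<tau> by (auto simp: indicator_def)
  have "((\<lambda>t. LINT \<tau>|interval_measure F. indicator {..min (-t) T} \<tau> *\<^sub>R h \<tau>) \<longlongrightarrow>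
      (LINT \<tau>|interval_measure F. 0)) at_top"
  proof (rule integral_dominated_convergence_at_top)
    show "integrable (interval_measure F) (\<lambda>\<tau>. \<bar>indicator {..T} \<tau> *\<^sub>R h \<tau>\<bar>)"
      using int by (rule integrable_abs)
    show "\<forall>\<^sub>F t in at_top. AE \<tau> in interval_measure F.
        norm (indicator {..min (-t) T} \<tau> *\<^sub>R h \<tau>) \<le> \<bar>indicator {..T} \<tau> *\<^sub>R h \<tau>\<bar>"
      by (auto simp: indicator_def)
    show "AE \<tau> in interval_measure F. ((\<lambda>t. indicator {..min (-t) T} \<tau> *\<^sub>R h \<tau>) \<longlongrightarrow> 0) at_top"
    proof (rule AE_I2, rule tendsto_eventually)
      fix \<tau>
      show "\<forall>\<^sub>F t in at_top. indicator {..min (-t) T} \<tau> *\<^sub>R h \<tau> = 0"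
        using eventually_gt_at_top[of "-\<tau>"] by eventually_elim (auto simp: indicator_def)
    qed
    show "(\<lambda>\<tau>. indicator {..min (-t) T} \<tau> *\<^sub>R h \<tau>) \<in> borel_measurable (interval_measure F)" for t
      unfolding restrict
      by (intro borel_measurable_scaleR borel_measurable_indicator borel_measurable_integrable[OF int]) auto
  qed auto
  then have "((\<lambda>t. LINT \<tau>|interval_measure F. indicator {..min t T} \<tau> *\<^sub>R h \<tau>) \<longlongrightarrow> 0) at_bot"
    by (simp add: filterlim_at_bot_mirror)
  moreover have "\<forall>\<^sub>F t in at_bot. (LINT \<tau>|interval_measure F. indicator {..min t T} \<tau> *\<^sub>R h \<tau>) =
      (LINT \<tau>:{..t}|interval_measure F. h \<tau>)"
    using eventually_le_at_bot[of T]
    by eventually_elim (simp add: set_lebesgue_integral_def min_absorb1)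
  ultimately show ?thesis by (rule Lim_transform_eventually)
qed

section \<open>Right tangents to a convex curve\<close>

text \<open>
  The graph of a strictly convex function, parametrized from left to right; \<open>k\<close> is the slope of the
  curve and \<open>d1\<close>, \<open>dk\<close> are the derivatives of \<open>c1\<close> and \<open>k\<close>.  Strict convexity is \<open>dk > 0\<close>.
\<close>

locale convex_graph =
  fixes c1 c2 k d1 dk :: "real \<Rightarrow> real"
  assumes DERIV_c1: "(c1 has_real_derivative d1 t) (at t)"
    and d1_pos: "0 < d1 t"
    and DERIV_c2: "(c2 has_real_derivative k t * d1 t) (at t)"
    and DERIV_k: "(k has_real_derivative dk t) (at t)"
    and dk_pos: "0 < dk t"
    and isCont_d1: "isCont d1 t"
    and isCont_dk: "isCont dk t"
begin

lemma strict_mono_c1: "strict_mono c1"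
  by (rule strict_monoI, rule DERIV_pos_imp_increasing) (use DERIV_c1 d1_pos in blast)+

lemma strict_mono_k: "strict_mono k"
  by (rule strict_monoI, rule DERIV_pos_imp_increasing) (use DERIV_k dk_pos in blast)+

lemmas c1_less_iff = strict_mono_less[OF strict_mono_c1]
  and c1_le_iff = strict_mono_less_eq[OF strict_mono_c1]
  and c1_eq_iff = strict_mono_eq[OF strict_mono_c1]

lemma isCont_c1: "isCont c1 t" and isCont_c2: "isCont c2 t" and isCont_k: "isCont k t"
  using DERIV_c1 DERIV_c2 DERIV_k by (blast intro: DERIV_isCont)+

lemma supporting_line_less:
  assumes "s \<noteq> r"
  shows "c2 r + k r * (c1 s - c1 r) < c2 s"
proof -
  define F where "F = (\<lambda>u. c2 u - k r * c1 u)"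
  have F': "(F has_real_derivative (k u - k r) * d1 u) (at u)" for u
    unfolding F_def by (auto intro!: derivative_eq_intros DERIV_c1 DERIV_c2 simp: algebra_simps)
  have "F r < F s"
  proof (cases "r < s")
    case True
    then obtain u where u: "r < u" "F s - F r = (s - r) * ((k u - k r) * d1 u)"
      using MVT2[of r s F "\<lambda>u. (k u - k r) * d1 u"] F' by blast
    moreover have "0 < (s - r) * ((k u - k r) * d1 u)"
      using True u d1_pos strict_mono_k by (auto simp: strict_mono_less)
    ultimately show ?thesis by linarith
  next
    case False
    with assms have sr: "s < r" by simp
    then obtain u where u: "u < r" "F r - F s = (r - s) * ((k u - k r) * d1 u)"
      using MVT2[of s r F "\<lambda>u. (k u - k r) * d1 u"] F' by blast
    moreover have "0 < (r - s) * ((k r - k u) * d1 u)"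
      using sr u d1_pos strict_mono_k by (auto simp: strict_mono_less)
    ultimately show ?thesis by (simp add: algebra_simps)
  qed
  then show ?thesis by (simp add: F_def algebra_simps)
qed

lemma supporting_line: "c2 r + k r * (c1 s - c1 r) \<le> c2 s"
  using supporting_line_less[of s r] by (cases "s = r") auto

lemma value_between:
  assumes "c1 r \<le> y" "y \<le> c1 s"
  obtains u where "r \<le> u" "u \<le> s" "c1 u = y"
proof -
  have "r \<le> s" using assms c1_le_iff by fastforce
  then show thesis
    using IVT[of c1 r y s] assms isCont_c1 that by blast
qed

text \<open>
  If the point at \<open>s\<close> were above the line \<open>p + q x\<close>, the supporting line there would be above it at one
  of the two ends, whatever its slope.
\<close>

lemma below_chord:
  assumes "r \<le> s" "s \<le> t"
    and "c2 r \<le> p + q * c1 r" "c2 t \<le> p + q * c1 t"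
  shows "c2 s \<le> p + q * c1 s"
proof (rule ccontr)
  assume "\<not> c2 s \<le> p + q * c1 s"
  moreover have "c2 s + k s * (c1 r - c1 s) \<le> c2 r" "c2 s + k s * (c1 t - c1 s) \<le> c2 t"
    by (rule supporting_line)+
  ultimately have "(k s - q) * (c1 r - c1 s) < 0" "(k s - q) * (c1 t - c1 s) < 0"
    using assms by (auto simp: algebra_simps)
  moreover have "c1 r \<le> c1 s" "c1 s \<le> c1 t" using assms c1_le_iff by auto
  ultimately show False by (auto simp: mult_less_0_iff)
qed

lemma above_extended_chord:
  assumes "r \<le> s" "s < t"
    and "p + q * c1 s \<le> c2 s" "c2 t \<le> p + q * c1 t"
  shows "p + q * c1 r \<le> c2 r"
proof -
  have "c2 s + k s * (c1 r - c1 s) \<le> c2 r" "c2 s + k s * (c1 t - c1 s) \<le> c2 t"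
    by (rule supporting_line)+
  then have "(k s - q) * (c1 t - c1 s) \<le> 0" and r: "p + q * c1 r + (k s - q) * (c1 r - c1 s) \<le> c2 r"
    using assms by (auto simp: algebra_simps)
  moreover have "c1 r \<le> c1 s" "c1 s < c1 t" using assms c1_le_iff c1_less_iff by auto
  ultimately have "k s - q \<le> 0" by (simp add: mult_le_0_iff)
  then have "0 \<le> (k s - q) * (c1 r - c1 s)"
    using \<open>c1 r \<le> c1 s\<close> by (simp add: mult_nonpos_nonpos)
  with r show ?thesis by simp
qed

end

text \<open>
  The fixed boundary \<open>g\<close> and the upper boundary \<open>h\<close>.  The equation
  \<open>g2 t - h2 s = m s * (g1 t - h1 s)\<close> says that the tangent to \<open>h\<close> at \<open>h s\<close> passes through \<open>g t\<close>.
  That \<open>h\<close> lies strictly above \<open>g\<close> follows from the existence of two tangents, see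
  \<open>tangency_on_both_sides\<close>.
\<close>

locale tangent_pair = g: convex_graph g1 g2 k d1 dk + h: convex_graph h1 h2 m e1 dm
  for g1 g2 k d1 dk h1 h2 m e1 dm :: "real \<Rightarrow> real" +
  assumes range_h1: "range h1 \<subseteq> range g1"
    and two_tangents: "card {s. g2 t - h2 s = m s * (g1 t - h1 s)} = 2"
    and second_intersection:
      "g2 t - h2 s = m s * (g1 t - h1 s) \<Longrightarrow> \<exists>r. r \<noteq> t \<and> g2 r - h2 s = m s * (g1 r - h1 s)"
begin

definition sR :: "real \<Rightarrow> real" where
  "sR t = Min {s. g2 t - h2 s = m s * (g1 t - h1 s)}"

definition sL :: "real \<Rightarrow> real" where
  "sL t = Max {s. g2 t - h2 s = m s * (g1 t - h1 s)}"

text \<open>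
  The signed vertical distance of \<open>g t\<close> from the tangent to \<open>h\<close> at \<open>h s\<close>.  Its zeros in \<open>s\<close> are
  the tangency parameters.
\<close>

definition height :: "real \<Rightarrow> real \<Rightarrow> real" where
  "height t s = g2 t - h2 s - m s * (g1 t - h1 s)"

abbreviation "w1 t \<equiv> h1 (sR t)"
abbreviation "w2 t \<equiv> h2 (sR t)"
abbreviation "\<kappa> t \<equiv> m (sR t)"

text \<open>
  When the point of contact moves, the tangent turns about that point, so only the change \<open>dm\<close> of
  the slope enters.  Hence the height decreases in \<open>s\<close> as long as the contact is to the left of
  \<open>g t\<close> and increases afterwards.
\<close>

lemma DERIV_height: "(height t has_real_derivative - dm s * (g1 t - h1 s)) (at s)"
  unfolding height_def
  by (auto intro!: derivative_eq_intros h.DERIV_c1 h.DERIV_c2 h.DERIV_k simp: algebra_simps)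

lemma height_less:
  assumes "s < s'" "h1 s' \<le> g1 t"
  shows "height t s' < height t s"
proof -
  obtain u where u: "u < s'" "height t s' - height t s = (s' - s) * (- dm u * (g1 t - h1 u))"
    using MVT2[of s s' "height t" "\<lambda>s. - dm s * (g1 t - h1 s)"] assms DERIV_height by blast
  have "h1 u < g1 t" using u assms h.c1_less_iff[of u s'] by linarith
  then have "(s' - s) * (- dm u * (g1 t - h1 u)) < 0"
    using assms h.dk_pos[of u] by (simp add: mult_pos_pos)
  with u show ?thesis by linarith
qed

text \<open>
  Between the two zeros of the height there is a critical point \<open>\<xi>\<close>, which lies vertically above
  \<open>g t\<close>; the height is negative there, that is, \<open>h \<xi>\<close> is above \<open>g t\<close>.  So one tangency point is
  strictly to the left and one strictly to the right of \<open>g t\<close>.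
\<close>

lemma tangency_on_both_sides:
  obtains \<xi> where "h1 \<xi> = g1 t" "g2 t < h2 \<xi>" "sR t < \<xi>" "\<xi> < sL t"
    and "{s. g2 t - h2 s = m s * (g1 t - h1 s)} = {sR t, sL t}"
proof -
  let ?T = "{s. g2 t - h2 s = m s * (g1 t - h1 s)}"
  have T: "s \<in> ?T \<longleftrightarrow> height t s = 0" for s by (auto simp: height_def)
  obtain a b where ab: "?T = {a, b}" "a < b"
  proof -
    obtain a b where "?T = {a, b}" "a \<noteq> b"
      using two_tangents[of t] by (auto simp: card_2_iff)
    then show thesis
      using that[of a b] that[of b a] by (cases "a < b") (auto simp: insert_commute)
  qed
  have s: "sR t = a" "sL t = b"
    using ab by (auto simp: sR_def sL_def)
  have 0: "height t a = 0" "height t b = 0"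
    using T[of a] T[of b] ab(1) by auto
  obtain \<xi> where \<xi>: "a < \<xi>" "\<xi> < b" "height t b - height t a = (b - a) * (- dm \<xi> * (g1 t - h1 \<xi>))"
    using MVT2[of a b "height t" "\<lambda>s. - dm s * (g1 t - h1 s)"] ab DERIV_height by blast
  then have eq: "h1 \<xi> = g1 t"
    using 0 h.dk_pos[of \<xi>] by auto
  then have "height t \<xi> < 0"
    using height_less[of a \<xi> t] \<xi> 0 by simp
  then have "g2 t < h2 \<xi>" using eq by (simp add: height_def)
  with eq \<xi> s ab show thesis by (intro that[of \<xi>]) auto
qed

lemma height_sR: "height t (sR t) = 0"
proof -
  obtain \<xi> where "{s. g2 t - h2 s = m s * (g1 t - h1 s)} = {sR t, sL t}"
    by (rule tangency_on_both_sides)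
  then have "sR t \<in> {s. g2 t - h2 s = m s * (g1 t - h1 s)}" by simp
  then show ?thesis by (simp add: height_def)
qed

lemma g2_eq: "g2 t - w2 t = \<kappa> t * (g1 t - w1 t)"
  using height_sR[of t] by (simp add: height_def)

lemma w1_less: "w1 t < g1 t"
proof -
  obtain \<xi> where "h1 \<xi> = g1 t" "sR t < \<xi>" by (rule tangency_on_both_sides)
  then show ?thesis using h.c1_less_iff[of "sR t" \<xi>] by simp
qed

lemma curve_below:
  assumes "h1 s = g1 t" shows "g2 t < h2 s"
proof -
  obtain \<xi> where "h1 \<xi> = g1 t" "g2 t < h2 \<xi>" by (rule tangency_on_both_sides)
  then show ?thesis using assms h.c1_eq_iff[of s \<xi>] by simp
qed

text \<open>
  The height changes sign at \<open>sR t\<close>; the signs slightly before and after persist for nearby \<open>t\<close>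
  and trap \<open>sR\<close> in between.
\<close>

lemma isCont_sR: "isCont sR t"
  unfolding continuous_at_eps_delta
proof (intro allI impI)
  fix e :: real assume "0 < e"
  obtain \<xi> where \<xi>: "h1 \<xi> = g1 t" "sR t < \<xi>" by (rule tangency_on_both_sides)
  define l where "l = sR t - e"
  define u where "u = min ((sR t + \<xi>) / 2) (sR t + e / 2)"
  have lu: "l < sR t" "sR t < u" "u < \<xi>" "u < sR t + e"
    using \<xi> \<open>0 < e\<close> by (auto simp: l_def u_def min_def field_simps)
  have hu: "h1 u < g1 t" using lu \<xi> h.c1_less_iff[of u \<xi>] by simp
  have "height t u < 0" using height_less[of "sR t" u t] lu hu height_sR by simp
  have "0 < height t l" using height_less[of l "sR t" t] lu w1_less[of t] height_sR by simp
  have cont: "(\<lambda>t'. height t' s) \<midarrow>t\<rightarrow> height t s" for s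
    unfolding height_def using g.isCont_c1 g.isCont_c2 by (intro tendsto_intros) (auto simp: isCont_def)
  have "g1 \<midarrow>t\<rightarrow> g1 t" using g.isCont_c1 by (simp add: isCont_def)
  then have "\<forall>\<^sub>F t' in at t. h1 u < g1 t'" using hu by (rule order_tendstoD)
  moreover have "\<forall>\<^sub>F t' in at t. height t' u < 0" "\<forall>\<^sub>F t' in at t. 0 < height t' l"
    using order_tendstoD(2)[OF cont \<open>height t u < 0\<close>] order_tendstoD(1)[OF cont \<open>0 < height t l\<close>] .
  ultimately have "\<forall>\<^sub>F t' in at t. dist (sR t') (sR t) < e"
  proof eventually_elim
    case (elim t')
    have "sR t' < u"
      using height_less[of u "sR t'" t'] height_sR[of t'] w1_less[of t'] elim
      by (cases u "sR t'" rule: linorder_cases) auto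
    moreover have "l < sR t'"
    proof (rule ccontr)
      assume "\<not> l < sR t'"
      moreover have "h1 l \<le> g1 t'" using elim lu h.c1_less_iff[of l u] by simp
      ultimately show False
        using height_less[of "sR t'" l t'] height_sR[of t'] elim by (cases "sR t' = l") auto
    qed
    ultimately show ?case using lu by (auto simp: dist_real_def l_def)
  qed
  then show "\<exists>d>0. \<forall>t'. dist t' t < d \<longrightarrow> dist (sR t') (sR t) < e"
    using \<open>0 < e\<close> by (auto simp: eventually_at) (metis dist_self)
qed

text \<open>
  Implicit differentiation of \<open>height t (sR t) = 0\<close>.
\<close>

definition sR' :: "real \<Rightarrow> real" where
  "sR' t = d1 t * (k t - \<kappa> t) / (dm (sR t) * (g1 t - w1 t))"

lemma DERIV_sR: "(sR has_real_derivative sR' t) (at t)"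
proof -
  let ?s = "sR t"
  have "((\<lambda>t'. height t' ?s) has_real_derivative d1 t * (k t - \<kappa> t)) (at t)"
    unfolding height_def
    by (auto intro!: derivative_eq_intros g.DERIV_c1 g.DERIV_c2 simp: algebra_simps)
  then obtain A where A: "\<And>t'. height t' ?s - height t ?s = A t' * (t' - t)" "isCont A t" "A t = d1 t * (k t - \<kappa> t)"
    by (auto simp: CARAT_DERIV)
  obtain C where C: "\<And>s. height t s - height t ?s = C s * (s - ?s)" "isCont C ?s"
      "C ?s = - dm ?s * (g1 t - w1 t)"
    using DERIV_height[of t ?s] by (auto simp: CARAT_DERIV)
  obtain M where M: "\<And>s. m s - m ?s = M s * (s - ?s)" "isCont M ?s"
    using h.DERIV_k[of ?s] by (auto simp: CARAT_DERIV)
  \<comment> \<open>the difference quotient in \<open>s\<close> of the height at the moved point \<open>g t'\<close>\<close>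
  define D where "D = (\<lambda>t'. C (sR t') - M (sR t') * (g1 t' - g1 t))"
  have key: "A t' * (t' - t) + D t' * (sR t' - ?s) = 0" for t'
  proof -
    have "A t' * (t' - t) + D t' * (sR t' - ?s) =
        (height t' ?s - height t ?s) + (height t (sR t') - height t ?s) - (m (sR t') - m ?s) * (g1 t' - g1 t)"
      unfolding A(1) C(1) M(1) by (simp add: D_def algebra_simps)
    also have "\<dots> = height t' (sR t') - height t ?s"
      by (simp add: height_def algebra_simps)
    finally show ?thesis by (simp add: height_sR)
  qed
  have "isCont D t"
    unfolding D_def
    using isCont_o2[OF isCont_sR C(2)] isCont_o2[OF isCont_sR M(2)] g.isCont_c1
    by (intro continuous_intros) auto
  moreover have Dt: "D t = - dm ?s * (g1 t - w1 t)" by (simp add: D_def C(3))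
  then have "D t \<noteq> 0" using h.dk_pos[of ?s] w1_less[of t] by auto
  ultimately have lim: "(\<lambda>t'. - (A t' / D t')) \<midarrow>t\<rightarrow> - (A t / D t)" and ne: "\<forall>\<^sub>F t' in at t. D t' \<noteq> 0"
    using A(2) by (auto simp: isCont_def intro!: tendsto_intros tendsto_imp_eventually_ne)
  have "(\<lambda>t'. (sR t' - ?s) / (t' - t)) \<midarrow>t\<rightarrow> - (A t / D t)"
  proof (rule Lim_transform_eventually[OF lim])
    show "\<forall>\<^sub>F t' in at t. - (A t' / D t') = (sR t' - ?s) / (t' - t)"
      using ne eventually_neq_at_within[of t t UNIV]
    proof eventually_elim
      case (elim t')
      then show ?case using key[of t'] by (simp add: field_simps) 
    qed
  qed
  moreover have "- (A t / D t) = sR' t"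
    using Dt A(3) by (simp add: sR'_def)
  ultimately show ?thesis by (simp add: has_field_derivative_iff)
qed

text \<open>
  Over the abscissa of \<open>w t\<close> the tangent is strictly above \<open>g\<close>.  If the second intersection were
  to the right, the curve would meet the line twice on that side, and by convexity it would be on or above the
  line everywhere to the left of both intersections.
\<close>

lemma left_intersection:
  obtains a where "a < t" "g1 a < w1 t" "g2 a - g2 t = \<kappa> t * (g1 a - g1 t)"
proof -
  obtain r where r: "r \<noteq> t" "g2 r - w2 t = \<kappa> t * (g1 r - w1 t)"
    using second_intersection[of t "sR t"] g2_eq[of t] by blast
  then have r': "g2 r = (g2 t - \<kappa> t * g1 t) + \<kappa> t * g1 r"
    using g2_eq[of t] by (simp add: algebra_simps)
  obtain q where q: "g1 q = w1 t" using range_h1 by (metis rangeE rangeI subsetD)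
  have "g2 q < w2 t" using curve_below q by simp
  then have gq: "g2 q < (g2 t - \<kappa> t * g1 t) + \<kappa> t * g1 q"
    using g2_eq[of t] by (simp add: q algebra_simps)
  have qt: "q < t" using q w1_less[of t] g.c1_less_iff by metis
  have "r < q"
  proof (rule ccontr)
    assume nless: "\<not> r < q"
    have "r \<noteq> q" using gq r' by auto
    define x y where "x = min r t" and "y = max r t"
    have xy: "q < x" "x < y" using nless \<open>r \<noteq> q\<close> qt r(1) by (auto simp: x_def y_def min_def max_def)
    have "g2 x = (g2 t - \<kappa> t * g1 t) + \<kappa> t * g1 x" "g2 y = (g2 t - \<kappa> t * g1 t) + \<kappa> t * g1 y"
      using r' by (auto simp: x_def y_def min_def max_def)
    then have "(g2 t - \<kappa> t * g1 t) + \<kappa> t * g1 q \<le> g2 q"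
      using xy by (intro g.above_extended_chord[of q x y]) auto
    then show False using gq by simp
  qed
  moreover have "g2 r - g2 t = \<kappa> t * (g1 r - g1 t)" using r' by (simp add: algebra_simps)
  ultimately show thesis using that[of r] qt q g.c1_less_iff[of r q] by simp
qed

lemma \<kappa>_less_k: "\<kappa> t < k t"
proof -
  obtain a where a: "a < t" "g2 a - g2 t = \<kappa> t * (g1 a - g1 t)" by (rule left_intersection)
  have "g2 t + k t * (g1 a - g1 t) < g2 a" using a by (intro g.supporting_line_less) auto
  then have "0 < (k t - \<kappa> t) * (g1 t - g1 a)" using a by (simp add: algebra_simps)
  moreover have "0 < g1 t - g1 a" using a g.c1_less_iff by simp
  ultimately show ?thesis by (simp add: zero_less_mult_iff)
qed

lemma sR'_pos: "0 < sR' t"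
  unfolding sR'_def using g.d1_pos \<kappa>_less_k[of t] h.dk_pos w1_less[of t] by simp

lemma strict_mono_sR: "strict_mono sR"
  by (rule strict_monoI, rule DERIV_pos_imp_increasing) (use DERIV_sR sR'_pos in blast)+

text \<open>
  The number with \<open>w' = lam (g - w)\<close>: the tangency point moves along the curve \<open>h\<close>, hence in the
  direction of its tangent, which points to \<open>g t\<close>.
\<close>

definition lam :: "real \<Rightarrow> real" where
  "lam t = e1 (sR t) * sR' t / (g1 t - w1 t)"

lemma lam_pos: "0 < lam t"
  unfolding lam_def using h.d1_pos sR'_pos w1_less[of t] by simp

lemma isCont_lam: "isCont lam t"
proof -
  have "isCont (\<lambda>t. e1 (sR t)) t" "isCont (\<lambda>t. dm (sR t)) t" "isCont (\<lambda>t. m (sR t)) t" "isCont (\<lambda>t. h1 (sR t)) t"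
    using h.isCont_d1 h.isCont_dk h.isCont_k h.isCont_c1 isCont_sR by (blast intro: isCont_o2)+
  then show ?thesis
    unfolding lam_def sR'_def using g.isCont_d1 g.isCont_k g.isCont_c1 w1_less[of t] h.dk_pos[of "sR t"]
    by (intro continuous_intros) auto
qed

lemma DERIV_w1: "(w1 has_real_derivative lam t * (g1 t - w1 t)) (at t)"
  using DERIV_chain2[OF h.DERIV_c1 DERIV_sR, of t] w1_less[of t] by (simp add: lam_def)

lemma DERIV_w2: "(w2 has_real_derivative lam t * (g2 t - w2 t)) (at t)"
  using DERIV_chain2[OF h.DERIV_c2 DERIV_sR, of t] w1_less[of t]
  unfolding g2_eq[of t] by (simp add: lam_def mult_ac)

lemma DERIV_\<kappa>: "(\<kappa> has_real_derivative d1 t * (k t - \<kappa> t) / (g1 t - w1 t)) (at t)"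
  using DERIV_chain2[OF h.DERIV_k DERIV_sR, of t] h.dk_pos[of "sR t"]
  by (simp add: sR'_def)

lemma tangent_below_curve: "g2 t + \<kappa> t * (h1 s - g1 t) \<le> h2 s"
  using h.supporting_line[of "sR t" s] g2_eq[of t] by (simp add: algebra_simps)

text \<open>
  The tangents to \<open>h\<close> from \<open>g r\<close> and from \<open>g t\<close> cross between \<open>w r\<close> and \<open>w t\<close>, and the first is
  the less steep one, so it is the upper one to the left of \<open>w r\<close>.  If the
  abscissa of \<open>g a\<close> is between those of \<open>w r\<close> and \<open>g r\<close> instead, convexity applies: \<open>g\<close> is on or below
  the tangent from \<open>g r\<close> over both.
\<close>

lemma tangent_above_chord_end:
  assumes "a \<le> r" "r < t" "g2 a - g2 t = \<kappa> t * (g1 a - g1 t)"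
  shows "g2 a \<le> g2 r + \<kappa> r * (g1 a - g1 r)"
proof (cases "g1 a \<le> w1 r")
  case True
  have "\<kappa> r \<le> \<kappa> t" using assms strict_mono_sR h.strict_mono_k by (simp add: strict_mono_less_eq)
  have "g2 a = w2 t + \<kappa> t * (g1 a - w1 t)" using assms(3) g2_eq[of t] by (simp add: algebra_simps)
  also have "\<dots> = w2 t + \<kappa> t * (w1 r - w1 t) + \<kappa> t * (g1 a - w1 r)" by (simp add: algebra_simps)
  also have "\<dots> \<le> w2 r + \<kappa> r * (g1 a - w1 r)"
    using h.supporting_line[of "sR t" "sR r"] True \<open>\<kappa> r \<le> \<kappa> t\<close>
    by (intro add_mono mult_right_mono_neg) auto
  finally show ?thesis using g2_eq[of r] by (simp add: algebra_simps)
next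
  case False
  obtain q where q: "g1 q = w1 r" using range_h1 by (metis rangeE rangeI subsetD)
  have "g2 q \<le> (g2 r - \<kappa> r * g1 r) + \<kappa> r * g1 q"
    using curve_below[of "sR r" q] q g2_eq[of r] by (simp add: algebra_simps)
  then have "g2 a \<le> (g2 r - \<kappa> r * g1 r) + \<kappa> r * g1 a"
    using assms(1) False q g.c1_le_iff[of q a] by (intro g.below_chord[of q a r]) auto
  then show ?thesis by (simp add: algebra_simps)
qed

end

section \<open>The candidate along the upper boundary\<close>

text \<open>
  \<open>f\<close> is the boundary datum, \<open>k3\<close> and \<open>K\<close> are the functions \<open>\<kappa>\<^sub>3\<close> and \<open>frak_K\<close>, and \<open>\<beta>\<close> is the coefficient \<open>\<beta>\<^sub>2\<close> of the standard candidate, so that \<open>K - \<beta>\<close> is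
  its memory integral.  \<open>\<Lambda>\<close> and \<open>R\<close> are antiderivatives of the two rates \<open>\<lambda>\<close> and
  \<open>\<rho> = k' / (k - \<kappa>)\<close>; only their differences have a meaning.
\<close>

locale delivery = tangent_pair g1 g2 k d1 dk h1 h2 m e1 dm
  for g1 g2 k d1 dk h1 h2 m e1 dm :: "real \<Rightarrow> real" +
  fixes \<Lambda> R f k3 K \<beta> :: "real \<Rightarrow> real" and v :: real
  assumes DERIV_\<Lambda>: "(\<Lambda> has_real_derivative lam t) (at t)"
    and DERIV_R: "(R has_real_derivative dk t / (k t - \<kappa> t)) (at t)"
    and DERIV_f: "(f has_real_derivative k3 t * d1 t) (at t)"
    and DERIV_k3: "(k3 has_real_derivative K t * dk t) (at t)"
    and DERIV_\<beta>: "t < v \<Longrightarrow> (\<beta> has_real_derivative dk t / (k t - \<kappa> t) * (K t - \<beta> t)) (at t)"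
    and decay: "((\<lambda>t. exp (R t) * (K t - \<beta> t)) \<longlongrightarrow> 0) at_bot"
begin

text \<open>
  The candidate is affine on the tangent segment from \<open>g t\<close>; this is its slope in the first
  coordinate.
\<close>

definition candidate_slope :: "real \<Rightarrow> real" where
  "candidate_slope t = k3 t + (\<kappa> t - k t) * \<beta> t"

definition candidate_at_w :: "real \<Rightarrow> real" where
  "candidate_at_w t = f t + (w1 t - g1 t) * candidate_slope t"

text \<open>
  The equation for \<open>\<beta>\<close> cancels both \<open>K\<close> and \<open>k'\<close>; what is left is \<open>\<kappa>' \<beta>\<close>.
\<close>

lemma DERIV_candidate_slope:
  assumes "t < v"
  shows "(candidate_slope has_real_derivative d1 t * (k t - \<kappa> t) / (g1 t - w1 t) * \<beta> t) (at t)"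
proof -
  define X where "X = d1 t * (k t - \<kappa> t) / (g1 t - w1 t)"
  have "(candidate_slope has_real_derivative
      K t * dk t + ((X - dk t) * \<beta> t + (dk t / (k t - \<kappa> t) * (K t - \<beta> t)) * (\<kappa> t - k t))) (at t)"
    unfolding candidate_slope_def X_def
    by (intro DERIV_add DERIV_mult DERIV_diff DERIV_k3 DERIV_\<kappa> g.DERIV_k DERIV_\<beta> assms)
  moreover have "(dk t / (k t - \<kappa> t) * (K t - \<beta> t)) * (\<kappa> t - k t) = - (dk t * (K t - \<beta> t))"
    using \<kappa>_less_k[of t] by (simp add: field_simps)
  ultimately show ?thesis
    unfolding X_def[symmetric] by (elim DERIV_cong) (simp add: algebra_simps)
qed

text \<open>
  The candidate at \<open>w\<close> obeys the law \<open>b' = \<lambda> (f - b)\<close>, which has the same form as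
  \<open>w' = \<lambda> (g - w)\<close>.  So the averages of \<open>f\<close> along a path whose averages are on \<open>w\<close> stay equal to the candidate.
\<close>

lemma DERIV_candidate_at_w:
  assumes "t < v"
  shows "(candidate_at_w has_real_derivative lam t * (f t - candidate_at_w t)) (at t)"
proof -
  have "(candidate_at_w has_real_derivative
      k3 t * d1 t + ((lam t * (g1 t - w1 t) - d1 t) * candidate_slope t +
        d1 t * (k t - \<kappa> t) / (g1 t - w1 t) * \<beta> t * (w1 t - g1 t))) (at t)"
    unfolding candidate_at_w_def
    by (intro DERIV_add DERIV_mult DERIV_diff DERIV_f DERIV_w1 g.DERIV_c1 DERIV_candidate_slope assms)
  moreover have "d1 t * (k t - \<kappa> t) / (g1 t - w1 t) * \<beta> t * (w1 t - g1 t) = - (d1 t * (k t - \<kappa> t) * \<beta> t)"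
    using w1_less[of t] by (simp add: field_simps)
  ultimately show ?thesis
    by (elim DERIV_cong) (simp add: candidate_at_w_def candidate_slope_def algebra_simps)
qed

text \<open>
  The rate \<open>\<lambda>\<close> of the average and the rate \<open>\<rho>\<close> of the memory are linked:
  \<open>((g\<^sub>1 - w\<^sub>1) (k - \<kappa>))' = (\<rho> - \<lambda>) (g\<^sub>1 - w\<^sub>1) (k - \<kappa>)\<close>.
\<close>

lemma conserved:
  "exp (\<Lambda> t - R t) * ((g1 t - w1 t) * (k t - \<kappa> t)) = exp (\<Lambda> s - R s) * ((g1 s - w1 s) * (k s - \<kappa> s))"
proof -
  have "((\<lambda>t. exp (\<Lambda> t - R t) * ((g1 t - w1 t) * (k t - \<kappa> t))) has_real_derivative 0) (at t)" for t
  proof -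
    have k\<kappa>: "k t - \<kappa> t \<noteq> 0" and gw: "g1 t - w1 t \<noteq> 0" using \<kappa>_less_k[of t] w1_less[of t] by auto
    define A B where "A = g1 t - w1 t" and "B = k t - \<kappa> t"
    have "((\<lambda>t. exp (\<Lambda> t - R t) * ((g1 t - w1 t) * (k t - \<kappa> t))) has_real_derivative
        exp (\<Lambda> t - R t) * (lam t - dk t / B) * (A * B) +
        exp (\<Lambda> t - R t) * ((d1 t - lam t * A) * B + A * (dk t - d1 t * B / A))) (at t)"
      unfolding A_def B_def
      by (rule derivative_eq_intros DERIV_\<Lambda> DERIV_R DERIV_w1 g.DERIV_c1 DERIV_\<kappa> g.DERIV_k refl)+ (simp add: algebra_simps)
    moreover have "exp (\<Lambda> t - R t) * (lam t - dk t / B) * (A * B) +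
        exp (\<Lambda> t - R t) * ((d1 t - lam t * A) * B + A * (dk t - d1 t * B / A)) = 0"
      using k\<kappa> gw unfolding A_def[symmetric] B_def[symmetric] by (simp add: field_simps)
    ultimately show ?thesis by simp
  qed
  then show ?thesis
    using DERIV_isconst_all[of "\<lambda>t. exp (\<Lambda> t - R t) * ((g1 t - w1 t) * (k t - \<kappa> t))" t s] by simp
qed

text \<open>
  The difference of the candidate slope and the slope of \<open>f\<close> over the chord from \<open>a\<close> to \<open>t\<close> is read
  off at \<open>r = t\<close> from \<open>Z r = f r - f a - (g1 r - g1 a) k3 r + Q r * \<beta> r\<close>, where
  \<open>Q r = (g1 r - g1 a) k r - (g2 r - g2 a)\<close>.  Since \<open>Q' = (g1 r - g1 a) k'\<close>, one gets
  \<open>Z' = - (K - \<beta>) (Q' - \<rho> Q)\<close>, while \<open>Y = exp (- R) Q\<close> has \<open>Y' = exp (- R) (Q' - \<rho> Q)\<close>.  The common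
  factor \<open>Q' - \<rho> Q\<close> is nonnegative because \<open>Q r \<le> (g1 r - g1 a) (k r - \<kappa> r)\<close>, which is
  \<open>tangent_above_chord_end\<close>.  So \<open>|Z'| \<le> \<eta> Y'\<close>, and both vanish at \<open>a\<close>.
\<close>

lemma chord_error_bound:
  assumes "t < v" "a < t" and chord: "g2 a - g2 t = \<kappa> t * (g1 a - g1 t)"
    and \<eta>: "\<And>r. r \<le> t \<Longrightarrow> \<bar>exp (R r) * (K r - \<beta> r)\<bar> \<le> \<eta>"
  shows "exp (\<Lambda> t) * (g1 t - w1 t) * \<bar>candidate_slope t - (f t - f a) / (g1 t - g1 a)\<bar>
      \<le> \<eta> * (exp (\<Lambda> s - R s) * ((g1 s - w1 s) * (k s - \<kappa> s)))"
proof -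
  define Q where "Q = (\<lambda>r. (g1 r - g1 a) * k r - (g2 r - g2 a))"
  define Z where "Z = (\<lambda>r. f r - f a - (g1 r - g1 a) * k3 r + Q r * \<beta> r)"
  define Y where "Y = (\<lambda>r. exp (- R r) * Q r)"
  define p where "p = (\<lambda>r. (g1 r - g1 a) * dk r - dk r / (k r - \<kappa> r) * Q r)"
  have Q': "(Q has_real_derivative (g1 r - g1 a) * dk r) (at r)" for r
    unfolding Q_def by (auto intro!: derivative_eq_intros g.DERIV_c1 g.DERIV_c2 g.DERIV_k simp: algebra_simps)
  have Y': "(Y has_real_derivative exp (- R r) * p r) (at r)" for r
    unfolding Y_def p_def
    by (rule derivative_eq_intros DERIV_R Q' refl)+ (simp add: algebra_simps)
  have Z': "(Z has_real_derivative - ((K r - \<beta> r) * p r)) (at r)" if "r \<le> t" for r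
  proof -
    have "((\<lambda>r. f r - f a) has_real_derivative k3 r * d1 r) (at r)"
      "((\<lambda>r. g1 r - g1 a) has_real_derivative d1 r) (at r)"
      by (auto intro!: derivative_eq_intros DERIV_f g.DERIV_c1)
    then have "(Z has_real_derivative (k3 r * d1 r - (d1 r * k3 r + K r * dk r * (g1 r - g1 a))) +
        ((g1 r - g1 a) * dk r * \<beta> r + dk r / (k r - \<kappa> r) * (K r - \<beta> r) * Q r)) (at r)"
      unfolding Z_def using that assms
      by (intro DERIV_add DERIV_mult DERIV_diff DERIV_k3 DERIV_\<beta> Q') auto
    then show ?thesis
      by (elim DERIV_cong) (simp add: p_def algebra_simps)
  qed
  have p: "0 \<le> p r" if "a \<le> r" "r \<le> t" for r
  proof -
    have "g2 a \<le> g2 r + \<kappa> r * (g1 a - g1 r)"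
      using tangent_above_chord_end[of a r t] that chord by (cases "r = t") (auto simp: algebra_simps)
    then have "Q r \<le> (g1 r - g1 a) * (k r - \<kappa> r)" by (simp add: Q_def algebra_simps)
    then have "dk r / (k r - \<kappa> r) * Q r \<le> dk r / (k r - \<kappa> r) * ((g1 r - g1 a) * (k r - \<kappa> r))"
      using \<kappa>_less_k[of r] g.dk_pos[of r] by (intro mult_left_mono) auto
    then show ?thesis using \<kappa>_less_k[of r] by (simp add: p_def mult.commute)
  qed
  have bound: "\<bar>(K r - \<beta> r) * p r\<bar> \<le> \<eta> * (exp (- R r) * p r)" if "a \<le> r" "r \<le> t" for r
  proof -
    have "\<bar>(K r - \<beta> r) * p r\<bar> = \<bar>exp (R r) * (K r - \<beta> r)\<bar> * (exp (- R r) * p r)"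
      using p[OF that] by (simp add: abs_mult exp_minus)
    also have "\<dots> \<le> \<eta> * (exp (- R r) * p r)"
      using \<eta> that p[OF that] by (intro mult_right_mono) auto
    finally show ?thesis .
  qed
  have at_a: "Z a = 0" "Y a = 0" by (auto simp: Z_def Y_def Q_def)
  have "\<eta> * Y a + Z a \<le> \<eta> * Y t + Z t"
  proof (rule DERIV_nonneg_imp_nondecreasing[where f = "\<lambda>r. \<eta> * Y r + Z r"])
    show "\<exists>y. ((\<lambda>r. \<eta> * Y r + Z r) has_real_derivative y) (at r) \<and> 0 \<le> y" if "a \<le> r" "r \<le> t" for r
      using bound[OF that] that
      by (intro exI[of _ "\<eta> * (exp (- R r) * p r) - (K r - \<beta> r) * p r"] conjI)
        (auto intro!: derivative_eq_intros Y' Z')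
  qed (use assms in auto)
  moreover have "\<eta> * Y a - Z a \<le> \<eta> * Y t - Z t"
  proof (rule DERIV_nonneg_imp_nondecreasing[where f = "\<lambda>r. \<eta> * Y r - Z r"])
    show "\<exists>y. ((\<lambda>r. \<eta> * Y r - Z r) has_real_derivative y) (at r) \<and> 0 \<le> y" if "a \<le> r" "r \<le> t" for r
      using bound[OF that] that
      by (intro exI[of _ "\<eta> * (exp (- R r) * p r) + (K r - \<beta> r) * p r"] conjI)
        (auto intro!: derivative_eq_intros Y' Z')
  qed (use assms in auto)
  ultimately have Zt: "\<bar>Z t\<bar> \<le> \<eta> * Y t" using at_a by simp
  define \<Delta> where "\<Delta> = g1 t - g1 a"
  have \<Delta>: "0 < \<Delta>" using assms g.c1_less_iff by (simp add: \<Delta>_def)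
  have Qt: "Q t = \<Delta> * (k t - \<kappa> t)" using chord by (simp add: Q_def \<Delta>_def algebra_simps)
  have "Z t = f t - f a - \<Delta> * candidate_slope t"
    unfolding Z_def Qt candidate_slope_def \<Delta>_def[symmetric] by (simp add: algebra_simps)
  also have "\<dots> = \<Delta> * ((f t - f a) / \<Delta> - candidate_slope t)"
    using \<Delta> by (subst right_diff_distrib) simp
  finally have "Z t = \<Delta> * ((f t - f a) / \<Delta> - candidate_slope t)" .
  then have "\<Delta> * \<bar>candidate_slope t - (f t - f a) / \<Delta>\<bar> \<le> \<Delta> * (\<eta> * (exp (- R t) * (k t - \<kappa> t)))"
    using Zt \<Delta> by (simp add: Y_def Qt abs_mult abs_minus_commute mult_ac)
  then have "\<bar>candidate_slope t - (f t - f a) / \<Delta>\<bar> \<le> \<eta> * (exp (- R t) * (k t - \<kappa> t))"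
    using \<Delta> by simp
  then have "exp (\<Lambda> t) * (g1 t - w1 t) * \<bar>candidate_slope t - (f t - f a) / \<Delta>\<bar> \<le>
      exp (\<Lambda> t) * (g1 t - w1 t) * (\<eta> * (exp (- R t) * (k t - \<kappa> t)))"
    using w1_less[of t] by (intro mult_left_mono) auto
  also have "\<dots> = \<eta> * (exp (\<Lambda> t - R t) * ((g1 t - w1 t) * (k t - \<kappa> t)))"
    by (simp add: exp_diff exp_minus field_simps)
  also note conserved[of t s]
  finally show ?thesis by (simp add: \<Delta>_def)
qed

definition chord_end :: "real \<Rightarrow> real" where
  "chord_end t = (SOME a. a < t \<and> g1 a < w1 t \<and> g2 a - g2 t = \<kappa> t * (g1 a - g1 t))"

lemma chord_end:
  "chord_end t < t" "g1 (chord_end t) < w1 t"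
  "g2 (chord_end t) - g2 t = \<kappa> t * (g1 (chord_end t) - g1 t)"
proof -
  have "\<exists>a. a < t \<and> g1 a < w1 t \<and> g2 a - g2 t = \<kappa> t * (g1 a - g1 t)"
    using left_intersection[of t] by metis
  from someI_ex[OF this] show "chord_end t < t" "g1 (chord_end t) < w1 t"
    "g2 (chord_end t) - g2 t = \<kappa> t * (g1 (chord_end t) - g1 t)"
    by (auto simp: chord_end_def)
qed

lemma chord_error_tendsto_0:
  "((\<lambda>t. exp (\<Lambda> t) * ((g1 t - w1 t) *
      (candidate_slope t - (f t - f (chord_end t)) / (g1 t - g1 (chord_end t))))) \<longlongrightarrow> 0) at_bot"
proof (rule tendstoI)
  fix e :: real assume "0 < e"
  define c where "c = exp (\<Lambda> 0 - R 0) * ((g1 0 - w1 0) * (k 0 - \<kappa> 0))"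
  have "0 < c" using w1_less[of 0] \<kappa>_less_k[of 0] by (simp add: c_def)
  have "\<forall>\<^sub>F t in at_bot. dist (exp (R t) * (K t - \<beta> t)) 0 < e / (2 * c)"
    using \<open>0 < e\<close> \<open>0 < c\<close> by (intro tendstoD[OF decay]) auto
  then obtain T where T: "\<And>t. t \<le> T \<Longrightarrow> \<bar>exp (R t) * (K t - \<beta> t)\<bar> \<le> e / (2 * c)"
    unfolding eventually_at_bot_linorder dist_real_def by (metis diff_zero less_imp_le)
  show "\<forall>\<^sub>F t in at_bot. dist (exp (\<Lambda> t) * ((g1 t - w1 t) *
      (candidate_slope t - (f t - f (chord_end t)) / (g1 t - g1 (chord_end t))))) 0 < e"
  proof -
    have "\<forall>\<^sub>F t in at_bot. t \<le> min T (v - 1)" by (rule eventually_le_at_bot)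
    then show ?thesis
    proof eventually_elim
      case (elim t)
      have "exp (\<Lambda> t) * (g1 t - w1 t) * \<bar>candidate_slope t - (f t - f (chord_end t)) / (g1 t - g1 (chord_end t))\<bar>
          \<le> e / (2 * c) * c"
        unfolding c_def using elim chord_end(1,3)[of t]
        by (intro chord_error_bound) (auto intro!: T simp: c_def[symmetric])
      also have "\<dots> < e" using \<open>0 < e\<close> \<open>0 < c\<close> by simp
      finally show ?case using w1_less[of t] by (simp add: abs_mult mult.assoc)
    qed
  qed
qed

end

section \<open>Averages of monotone functions\<close>

lemma nondegenerate_interval_endpoints:
  assumes "nondegenerate_interval J"
  obtains c d where "c < d" "{c<..<d} \<subseteq> J" "J \<subseteq> {c..d}"
proof -
  have J: "is_interval J" "bdd_below J" "bdd_above J" "interior J \<noteq> {}"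
    using assms bounded_imp_bdd_below bounded_imp_bdd_above
    by (auto simp: nondegenerate_interval_def)
  then obtain x e where "0 < e" "ball x e \<subseteq> J"
    using open_contains_ball[of "interior J"] interior_subset by blast
  then have "x - e / 2 \<in> J" "x + e / 2 \<in> J" by (auto simp: subset_iff dist_real_def)
  then have "Inf J < Sup J"
    using cInf_lower[of "x - e / 2" J] cSup_upper[of "x + e / 2" J] J(2,3) \<open>0 < e\<close> by linarith
  moreover have "{Inf J<..<Sup J} \<subseteq> J"
  proof
    fix y assume y: "y \<in> {Inf J<..<Sup J}"
    have "J \<noteq> {}" using J(4) by auto
    obtain p q where "p \<in> J" "p < y" "q \<in> J" "y < q"
      using y cInf_less_iff[OF \<open>J \<noteq> {}\<close> J(2)] less_cSup_iff[OF \<open>J \<noteq> {}\<close> J(3)] by auto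
    then show "y \<in> J" using J(1) by (meson is_interval_1 less_imp_le)
  qed
  moreover have "J \<subseteq> {Inf J..Sup J}"
    using J(2,3) by (auto intro: cInf_lower cSup_upper)
  ultimately show thesis by (rule that)
qed

text \<open>
  A continuous function of a bounded monotone function is Borel measurable and bounded.
\<close>

lemma set_integrable_continuous_mono:
  fixes \<psi> :: "real \<Rightarrow> 'a :: {second_countable_topology, banach}" and \<theta> :: "real \<Rightarrow> real"
  assumes \<psi>: "continuous_on UNIV \<psi>" and \<theta>: "mono \<theta>" "\<And>s. lo \<le> \<theta> s" "\<And>s. \<theta> s \<le> hi"
    and J: "J \<in> sets lebesgue" "J \<subseteq> {c..d}"
  shows "set_integrable lebesgue J (\<lambda>s. \<psi> (\<theta> s))"
proof -
  have "\<theta> \<in> borel_measurable borel" using \<theta>(1) by (rule borel_measurable_mono)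
  then have "(\<lambda>s. \<psi> (\<theta> s)) \<in> borel_measurable borel"
    using borel_measurable_continuous_onI[OF \<psi>] by measurable
  then have meas: "(\<lambda>s. \<psi> (\<theta> s)) \<in> borel_measurable lebesgue"
    by (simp add: measurable_completion)
  have "bounded (\<psi> ` {lo..hi})"
    using \<psi> by (intro compact_imp_bounded compact_continuous_image) (auto intro: continuous_on_subset)
  then obtain b where b: "\<And>r. r \<in> {lo..hi} \<Longrightarrow> norm (\<psi> r) \<le> b"
    by (metis bounded_iff imageI)
  have "emeasure lebesgue J \<le> emeasure lebesgue {c..d}" using J by (intro emeasure_mono) auto
  also have "\<dots> < \<infinity>" by (simp add: emeasure_lborel_cbox_eq[of c d, simplified] less_top[symmetric] )
  finally show ?thesis
    unfolding set_integrable_def using meas J(1) b \<theta>(2,3)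
    by (intro integrableI_bounded_set_indicator[where B = b]) auto
qed

text \<open>
  An interval is given by its endpoints only, since averages do not depend on whether these belong to
  it.
\<close>

lemma average_eq_integral:
  fixes \<psi> :: "real \<Rightarrow> 'a :: euclidean_space" and \<theta> :: "real \<Rightarrow> real"
  assumes \<psi>: "continuous_on UNIV \<psi>" and \<theta>: "mono \<theta>" "\<And>s. lo \<le> \<theta> s" "\<And>s. \<theta> s \<le> hi"
    and cd: "c < d" "{c<..<d} \<subseteq> J" "J \<subseteq> {c..d}"
  shows "set_integrable lebesgue J (\<lambda>s. \<psi> (\<theta> s))"
    and "(\<lambda>s. \<psi> (\<theta> s)) integrable_on {c..d}"
    and "average J (\<lambda>s. \<psi> (\<theta> s)) = (1 / (d - c)) *\<^sub>R integral {c..d} (\<lambda>s. \<psi> (\<theta> s))"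
proof -
  have diff: "{c..d} - J \<subseteq> {c, d}" using cd by (auto simp: subset_iff) (metis less_eq_real_def)
  then have neg: "negligible ({c..d} - J)" by (rule negligible_subset[rotated]) simp
  have "J = {c..d} - ({c..d} - J)" using cd by auto
  then have J: "J \<in> sets lebesgue"
    using negligible_imp_sets[OF neg] by (metis sets.Diff atLeastAtMost_borel sets_completionI_sets sets_lborel)
  show int: "set_integrable lebesgue J (\<lambda>s. \<psi> (\<theta> s))"
    using set_integrable_continuous_mono[OF \<psi> \<theta> J cd(3)] .
  have "set_integrable lebesgue {c..d} (\<lambda>s. \<psi> (\<theta> s))"
    by (rule set_integrable_continuous_mono[OF \<psi> \<theta>]) auto
  then show "(\<lambda>s. \<psi> (\<theta> s)) integrable_on {c..d}" by (rule set_lebesgue_integral_eq_integral)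
  have "measure lebesgue J = measure lebesgue {c..d}"
    using cd neg by (intro measure_negligible_symdiff) (auto simp: Un_absorb2 Diff_eq_empty_iff)
  then have "measure lebesgue J = d - c" using cd(1) by simp
  moreover have "(LINT s:J|lebesgue. \<psi> (\<theta> s)) = integral J (\<lambda>s. \<psi> (\<theta> s))"
    using int by (rule set_lebesgue_integral_eq_integral)
  moreover have "integral J (\<lambda>s. \<psi> (\<theta> s)) = integral {c..d} (\<lambda>s. \<psi> (\<theta> s))"
    using cd by (intro integral_spike_set negligible_subset[OF neg]) auto
  ultimately show "average J (\<lambda>s. \<psi> (\<theta> s)) = (1 / (d - c)) *\<^sub>R integral {c..d} (\<lambda>s. \<psi> (\<theta> s))"
    by (simp add: average_def)
qed

context tangent_pair
begin

definition above_tangent :: "real \<Rightarrow> real \<Rightarrow> real" where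
  "above_tangent t r = g2 r - g2 t - \<kappa> t * (g1 r - g1 t)"

lemma continuous_on_above_tangent: "continuous_on UNIV (above_tangent t)"
  unfolding above_tangent_def
  using g.isCont_c1 g.isCont_c2 by (intro continuous_at_imp_continuous_on ballI continuous_intros) auto

lemma above_tangent_sign:
  obtains a where "\<And>r. r \<le> a \<Longrightarrow> 0 \<le> above_tangent t r"
    and "\<And>r. a \<le> r \<Longrightarrow> r \<le> t \<Longrightarrow> above_tangent t r \<le> 0"
proof -
  obtain a where a: "a < t" "g2 a - g2 t = \<kappa> t * (g1 a - g1 t)" by (rule left_intersection)
  have a': "g2 a = (g2 t - \<kappa> t * g1 t) + \<kappa> t * g1 a" using a by (simp add: algebra_simps)
  show thesis
  proof (rule that[of a])
    fix r assume "r \<le> a"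
    then have "(g2 t - \<kappa> t * g1 t) + \<kappa> t * g1 r \<le> g2 r"
      using a a' by (intro g.above_extended_chord[of r a t]) auto
    then show "0 \<le> above_tangent t r" by (simp add: above_tangent_def algebra_simps)
  next
    fix r assume "a \<le> r" "r \<le> t"
    then have "g2 r \<le> (g2 t - \<kappa> t * g1 t) + \<kappa> t * g1 r"
      using a a' by (intro g.below_chord[of a r t]) auto
    then show "above_tangent t r \<le> 0" by (simp add: above_tangent_def algebra_simps)
  qed
qed

text \<open>
  Consider the tangent from \<open>g (\<theta> d)\<close>.  As \<open>\<theta>\<close> increases to \<open>\<theta> d\<close>, the height of \<open>g (\<theta> s)\<close> over it
  is first nonnegative and then nonpositive.  Its integral up to \<open>d\<close> is at most 0, so the integral over
  any final piece \<open>{c..d}\<close> is at most 0 as well: either the height is nonpositive on all of the piece,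
  or the part up to \<open>c\<close> that is split off is nonnegative.  Hence the average is on or below this tangent, and
  so on or below \<open>h\<close>.  It is on or above \<open>g\<close> by Jensen's inequality.
\<close>

lemma average_between_curves:
  assumes \<theta>: "mono \<theta>" "\<And>s. lo \<le> \<theta> s" "\<And>s. \<theta> s \<le> hi"
    and tangent: "\<forall>d. \<alpha> < d \<longrightarrow> d \<le> b \<longrightarrow> integral {\<alpha>..d} (\<lambda>s. above_tangent (\<theta> d) (\<theta> s)) \<le> 0"
    and cd: "\<alpha> \<le> c" "c < d" "d \<le> b"
  obtains r s where "integral {c..d} (\<lambda>s. g1 (\<theta> s)) / (d - c) = g1 r" "h1 s = g1 r"
    and "g2 r \<le> integral {c..d} (\<lambda>s. g2 (\<theta> s)) / (d - c)"
    and "integral {c..d} (\<lambda>s. g2 (\<theta> s)) / (d - c) \<le> h2 s"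
proof -
  have cont: "continuous_on UNIV g1" "continuous_on UNIV g2"
    using g.isCont_c1 g.isCont_c2 by (auto intro: continuous_at_imp_continuous_on)
  have int: "(\<lambda>s. \<psi> (\<theta> s)) integrable_on {p..q}" if "continuous_on UNIV \<psi>" "p < q" for p q and \<psi> :: "real \<Rightarrow> real"
    using average_eq_integral(2)[OF that(1) \<theta> that(2) greaterThanLessThan_subseteq_atLeastAtMost_iff[THEN iffD2] order_refl] by simp
  define y1 y2 where "y1 = integral {c..d} (\<lambda>s. g1 (\<theta> s)) / (d - c)"
    and "y2 = integral {c..d} (\<lambda>s. g2 (\<theta> s)) / (d - c)"
  have y: "integral {c..d} (\<lambda>s. g1 (\<theta> s)) = (d - c) * y1" "integral {c..d} (\<lambda>s. g2 (\<theta> s)) = (d - c) * y2"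
    using cd by (auto simp: y1_def y2_def)
  have affine: "integral {c..d} (\<lambda>s. g2 (\<theta> s) - p - q * (g1 (\<theta> s) - u)) = (d - c) * (y2 - p - q * (y1 - u))" for p q u
  proof -
    have "((\<lambda>s. g2 (\<theta> s) - p - q * (g1 (\<theta> s) - u)) has_integral
        (d - c) * y2 - (d - c) *\<^sub>R p - q * ((d - c) * y1 - (d - c) *\<^sub>R u)) {c..d}"
      using int[OF cont(1) cd(2)] int[OF cont(2) cd(2)] cd(2) y has_integral_const_real[of p c d] has_integral_const_real[of u c d]
      by (intro has_integral_diff has_integral_mult_right) (auto simp: has_integral_iff)
    then show ?thesis by (simp add: has_integral_iff algebra_simps)
  qed
  have "(d - c) * g1 lo \<le> (d - c) * y1" "(d - c) * y1 \<le> (d - c) * g1 hi"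
  proof -
    have "integral {c..d} (\<lambda>s. g1 lo) \<le> integral {c..d} (\<lambda>s. g1 (\<theta> s))"
      using \<theta>(2) g.c1_le_iff cd by (intro integral_le int cont) auto
    then show "(d - c) * g1 lo \<le> (d - c) * y1" using y cd by simp
    have "integral {c..d} (\<lambda>s. g1 (\<theta> s)) \<le> integral {c..d} (\<lambda>s. g1 hi)"
      using \<theta>(3) g.c1_le_iff cd by (intro integral_le int cont) auto
    then show "(d - c) * y1 \<le> (d - c) * g1 hi" using y cd by simp
  qed
  then obtain r where r: "g1 r = y1"
    using cd g.value_between[of lo y1 hi] by auto
  obtain s where s: "h1 s = g1 r" using tangency_on_both_sides[of r] by metis
  have "g2 r \<le> y2"
  proof -
    have "0 \<le> integral {c..d} (\<lambda>s. g2 (\<theta> s) - g2 r - k r * (g1 (\<theta> s) - g1 r))"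
    proof (rule integral_nonneg)
      have "continuous_on UNIV (\<lambda>t. g2 t - g2 r - k r * (g1 t - g1 r))"
        using cont by (intro continuous_intros)
      from int[OF this cd(2)]
      show "(\<lambda>s. g2 (\<theta> s) - g2 r - k r * (g1 (\<theta> s) - g1 r)) integrable_on {c..d}" .
      show "0 \<le> g2 (\<theta> s) - g2 r - k r * (g1 (\<theta> s) - g1 r)" for s
        using g.supporting_line[of r "\<theta> s"] by (simp add: algebra_simps)
    qed
    then show ?thesis using cd r unfolding affine by (simp add: zero_le_mult_iff)
  qed
  moreover have "y2 \<le> h2 s"
  proof -
    let ?L = "\<lambda>s. above_tangent (\<theta> d) (\<theta> s)"
    have intL: "?L integrable_on {p..q}" if "p < q" for p q
      using int[OF continuous_on_above_tangent that] .
    obtain a where a: "\<And>r. r \<le> a \<Longrightarrow> 0 \<le> above_tangent (\<theta> d) r"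
      "\<And>r. a \<le> r \<Longrightarrow> r \<le> \<theta> d \<Longrightarrow> above_tangent (\<theta> d) r \<le> 0"
      using above_tangent_sign[of "\<theta> d"] by metis
    have "integral {c..d} ?L \<le> 0"
    proof (cases "a \<le> \<theta> c")
      case True
      have "integral {c..d} ?L \<le> integral {c..d} (\<lambda>_. 0)"
      proof (rule integral_le)
        fix s assume "s \<in> {c..d}"
        then have "\<theta> c \<le> \<theta> s" "\<theta> s \<le> \<theta> d" using \<theta>(1) by (auto dest: monoD)
        then show "?L s \<le> 0" using a(2) True by auto
      qed (use intL cd in auto)
      then show ?thesis by simp
    next
      case False
      have "0 \<le> integral {\<alpha>..c} ?L"
      proof (cases "\<alpha> < c")
        case True
        show ?thesis
        proof (rule integral_nonneg)
          fix s assume "s \<in> {\<alpha>..c}"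
          then have "\<theta> s \<le> \<theta> c" using \<theta>(1) by (auto dest: monoD)
          then show "0 \<le> ?L s" using a(1) False by auto
        qed (use intL True in auto)
      next
        case False
        then show ?thesis using cd by simp
      qed
      moreover have "integral {\<alpha>..c} ?L + integral {c..d} ?L = integral {\<alpha>..d} ?L"
        using cd intL by (intro Henstock_Kurzweil_Integration.integral_combine) auto
      ultimately show ?thesis using tangent[rule_format, of d] cd by simp
    qed
    then have "y2 - g2 (\<theta> d) - \<kappa> (\<theta> d) * (y1 - g1 (\<theta> d)) \<le> 0"
      using cd unfolding above_tangent_def affine by (simp add: mult_le_0_iff)
    then show ?thesis
      using tangent_below_curve[of "\<theta> d" s] s r by simp
  qed
  ultimately show thesis
    using r s by (intro that[of r s]) (auto simp: y1_def y2_def)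
qed

end

section \<open>The delivery path\<close>

context delivery
begin

text \<open>
  The proportion in which \<open>w t\<close> divides the chord of \<open>g\<close> that touches \<open>h\<close> at \<open>w t\<close>.
\<close>

definition chord_weight :: "real \<Rightarrow> real" where
  "chord_weight t = (g1 t - w1 t) / (g1 t - g1 (chord_end t))"

lemma chord_weight:
  shows "0 < chord_weight t" "chord_weight t < 1"
    and "g1 t - chord_weight t * (g1 t - g1 (chord_end t)) = w1 t"
    and "g2 t - chord_weight t * (g2 t - g2 (chord_end t)) = w2 t"
proof -
  have less: "g1 (chord_end t) < g1 t" using chord_end(1) by (simp add: g.c1_less_iff)
  then show "0 < chord_weight t" "chord_weight t < 1"
    using w1_less[of t] chord_end(2)[of t] by (auto simp: chord_weight_def)
  show 1: "g1 t - chord_weight t * (g1 t - g1 (chord_end t)) = w1 t"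
    using less by (simp add: chord_weight_def)
  have "g2 t - g2 (chord_end t) = \<kappa> t * (g1 t - g1 (chord_end t))"
    using chord_end(3)[of t] by (simp add: algebra_simps)
  then have "g2 t - chord_weight t * (g2 t - g2 (chord_end t)) =
      g2 t - \<kappa> t * (chord_weight t * (g1 t - g1 (chord_end t)))" by simp
  also have "chord_weight t * (g1 t - g1 (chord_end t)) = g1 t - w1 t" using 1 by simp
  finally show "g2 t - chord_weight t * (g2 t - g2 (chord_end t)) = w2 t" using g2_eq[of t] by simp
qed

lemma strict_mono_\<Lambda>: "strict_mono \<Lambda>"
  by (rule strict_monoI, rule DERIV_pos_imp_increasing) (use DERIV_\<Lambda> lam_pos in blast)+

text \<open>
  The last clause is the integral formula that \<open>g1\<close>, \<open>g2\<close>, the tangent functionals and \<open>f\<close> share.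
  If \<open>\<Psi>' = \<lambda> (\<psi> - \<Psi>)\<close>, then \<open>\<psi> \<circ> \<theta>\<close> has the average \<open>\<Psi> t0\<close> over an initial part of length \<open>C\<close>, up
  to an error caused by the start at \<open>t1\<close>, and is constantly \<open>\<psi> t0\<close> afterwards.
\<close>

definition delivery_path :: "real \<Rightarrow> real \<Rightarrow> real \<Rightarrow> real \<Rightarrow> real \<Rightarrow> (real \<Rightarrow> real) \<Rightarrow> bool" where
  "delivery_path t1 t0 C \<alpha> b \<theta> \<longleftrightarrow>
     mono \<theta> \<and> (\<forall>s. chord_end t1 \<le> \<theta> s) \<and> (\<forall>s. \<theta> s \<le> t0) \<and>
     (\<forall>d. \<alpha> < d \<longrightarrow> d \<le> b \<longrightarrow> integral {\<alpha>..d} (\<lambda>s. above_tangent (\<theta> d) (\<theta> s)) \<le> 0) \<and>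
     (\<forall>\<psi> \<Psi>. (\<forall>t\<le>t0. (\<Psi> has_real_derivative lam t * (\<psi> t - \<Psi> t)) (at t)) \<longrightarrow>
        integral {\<alpha>..b} (\<lambda>s. \<psi> (\<theta> s)) = C * \<Psi> t0 + (b - \<alpha> - C) * \<psi> t0 -
          C * exp (\<Lambda> t1 - \<Lambda> t0) * (\<Psi> t1 - (\<psi> t1 - chord_weight t1 * (\<psi> t1 - \<psi> (chord_end t1)))))"

text \<open>
  The path stays at the left chord end up to time \<open>\<sigma>\<close>, then at \<open>t1\<close> up to time \<open>N t1\<close>, so that the
  average is \<open>w t1\<close> at that time, then follows the inverse function of \<open>N\<close>, and stays at
  \<open>t0\<close> from \<open>N t0\<close> on.  On the middle part \<open>(s - \<alpha>) \<Psi> (\<theta> s)\<close> is an antiderivative of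
  \<open>\<psi> (\<theta> s)\<close>.
\<close>

lemma delivery_path_exists:
  assumes "t1 < t0" "0 < C" "\<alpha> + C \<le> b"
  shows "\<exists>\<theta>. delivery_path t1 t0 C \<alpha> b \<theta>"
proof -
  define p where "p = chord_weight t1"
  define a where "a = chord_end t1"
  define N where "N = (\<lambda>t. \<alpha> + C * exp (\<Lambda> t - \<Lambda> t0))"
  define M where "M = inv N"
  define \<sigma> where "\<sigma> = \<alpha> + (N t1 - \<alpha>) * p"
  define \<theta> where "\<theta> = (\<lambda>s. if s \<le> \<sigma> then a else M (max (N t1) (min s (N t0))))"
  have a: "a < t1" using chord_end by (simp add: a_def)
  have p: "0 < p" "p < 1" using chord_weight[of t1] by (auto simp: p_def)
  have N': "(N has_real_derivative C * exp (\<Lambda> t - \<Lambda> t0) * lam t) (at t)" for t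
    unfolding N_def by (auto intro!: derivative_eq_intros DERIV_\<Lambda>)
  have N_mono: "strict_mono N"
    using strict_mono_\<Lambda> \<open>0 < C\<close> by (auto simp: N_def strict_mono_def)
  have N_gt: "\<alpha> < N t" for t using \<open>0 < C\<close> by (simp add: N_def)
  have N_t0: "N t0 = \<alpha> + C" by (simp add: N_def)
  have N_t1: "N t1 = \<alpha> + C * exp (\<Lambda> t1 - \<Lambda> t0)" by (simp add: N_def)
  have N_less: "N t1 < N t0" using N_mono \<open>t1 < t0\<close> by (simp add: strict_mono_less)
  have \<sigma>: "\<alpha> < \<sigma>" "\<sigma> < N t1"
  proof -
    have "0 < (N t1 - \<alpha>) * p" "(N t1 - \<alpha>) * p < N t1 - \<alpha>"
      using p N_gt[of t1] by (simp_all add: mult_less_cancel_left1)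
    then show "\<alpha> < \<sigma>" "\<sigma> < N t1" unfolding \<sigma>_def by linarith+
  qed
  have M_N: "M (N t) = t" for t
    unfolding M_def using N_mono by (simp add: strict_mono_imp_inj_on inv_f_f)
  have N_isCont: "isCont N t" for t using N' by (rule DERIV_isCont)
  have N_onto: "\<exists>t. t1 \<le> t \<and> t \<le> t0 \<and> s = N t" if "N t1 \<le> s" "s \<le> N t0" for s
    using IVT[of N t1 s t0] that N_isCont \<open>t1 < t0\<close> by auto
  have \<theta>_a: "\<theta> s = a" if "s \<le> \<sigma>" for s using that by (simp add: \<theta>_def)
  have \<theta>_t1: "\<theta> s = t1" if "\<sigma> < s" "s \<le> N t1" for s
    using that N_less by (simp add: \<theta>_def M_N max_def min_def)
  have \<theta>_N: "\<theta> (N t) = t" if "t1 \<le> t" "t \<le> t0" for t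
  proof -
    have "N t1 \<le> N t" "N t \<le> N t0" using N_mono that by (auto simp: strict_mono_less_eq)
    then show ?thesis using \<sigma> by (simp add: \<theta>_def M_N max_def min_def)
  qed
  have \<theta>_t0: "\<theta> s = t0" if "N t0 \<le> s" for s
    using that N_less \<sigma> by (simp add: \<theta>_def M_N max_def min_def)
  have range: "s \<le> \<sigma> \<and> \<theta> s = a \<or> \<sigma> < s \<and> t1 \<le> \<theta> s \<and> \<theta> s \<le> t0 \<and> N (\<theta> s) = max (N t1) (min s (N t0))" for s
  proof -
    have "N t1 \<le> max (N t1) (min s (N t0))" "max (N t1) (min s (N t0)) \<le> N t0"
      using N_less by auto
    then obtain t where "t1 \<le> t" "t \<le> t0" "max (N t1) (min s (N t0)) = N t"
      using N_onto by blast
    then show ?thesis by (auto simp: \<theta>_def M_N)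
  qed
  have "mono \<theta>"
  proof (rule monoI)
    fix s s' :: real assume "s \<le> s'"
    show "\<theta> s \<le> \<theta> s'"
    proof (cases "s \<le> \<sigma>")
      case True
      then show ?thesis using range[of s] range[of s'] a by auto
    next
      case False
      then have "N (\<theta> s) \<le> N (\<theta> s')"
        using range[of s] range[of s'] \<open>s \<le> s'\<close> by (auto simp: max_def min_def)
      then show ?thesis using N_mono by (simp add: strict_mono_less_eq)
    qed
  qed
  have \<theta>_lo: "a \<le> \<theta> s" and \<theta>_hi: "\<theta> s \<le> t0" for s
    using range[of s] a \<open>t1 < t0\<close> by auto
  have int: "(\<lambda>s. \<psi> (\<theta> s)) integrable_on {c..d}" if "continuous_on UNIV \<psi>" "c < d" for c d and \<psi> :: "real \<Rightarrow> real"
    using average_eq_integral(2)[OF that(1) \<open>mono \<theta>\<close> \<theta>_lo \<theta>_hi that(2)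
        greaterThanLessThan_subseteq_atLeastAtMost_iff[THEN iffD2] order_refl] by simp
  have chord_part: "((\<lambda>s. \<psi> (\<theta> s)) has_integral (N t1 - \<alpha>) * (\<psi> t1 - p * (\<psi> t1 - \<psi> a))) {\<alpha>..N t1}"
    for \<psi> :: "real \<Rightarrow> real"
  proof -
    have "((\<lambda>s. \<psi> (\<theta> s)) has_integral (\<sigma> - \<alpha>) *\<^sub>R \<psi> a) {\<alpha>..\<sigma>}"
      using \<sigma> has_integral_const_real[of "\<psi> a" \<alpha> \<sigma>]
      by (auto simp: \<theta>_a intro: has_integral_eq[rotated])
    moreover have "((\<lambda>s. \<psi> (\<theta> s)) has_integral (N t1 - \<sigma>) *\<^sub>R \<psi> t1) {\<sigma>..N t1}"
      using \<sigma> has_integral_const_real[of "\<psi> t1" \<sigma> "N t1"]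
      by (intro has_integral_spike_finite[of "{\<sigma>}" "{\<sigma>..N t1}" "\<lambda>s. \<psi> (\<theta> s)" "\<lambda>_. \<psi> t1"]) (auto simp: \<theta>_t1)
    ultimately have "((\<lambda>s. \<psi> (\<theta> s)) has_integral (\<sigma> - \<alpha>) *\<^sub>R \<psi> a + (N t1 - \<sigma>) *\<^sub>R \<psi> t1) {\<alpha>..N t1}"
      using \<sigma> by (intro has_integral_combine[of \<alpha> \<sigma> "N t1"]) auto
    then show ?thesis by (simp add: \<sigma>_def algebra_simps)
  qed
  have main_part: "((\<lambda>s. \<psi> (\<theta> s)) has_integral (N t - \<alpha>) * \<Psi> t - (N t1 - \<alpha>) * \<Psi> t1) {N t1..N t}"
    if t: "t1 \<le> t" "t \<le> t0" and \<Psi>: "\<And>t. t \<le> t0 \<Longrightarrow> (\<Psi> has_real_derivative lam t * (\<psi> t - \<Psi> t)) (at t)"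
    for t and \<psi> \<Psi> :: "real \<Rightarrow> real"
  proof -
    have M': "(M has_real_derivative inverse (C * exp (\<Lambda> u - \<Lambda> t0) * lam u)) (at (N u))" for u
    proof -
      define c where "c = C * exp (\<Lambda> u - \<Lambda> t0) * lam u"
      have "c \<noteq> 0" using lam_pos[of u] \<open>0 < C\<close> by (simp add: c_def)
      have "(M has_derivative (*) (inverse c)) (at (N u))"
      proof (rule has_derivative_inverse_strong[where S = UNIV and f = N and x = u])
        show "continuous_on UNIV N" using N_isCont by (simp add: continuous_on_eq_continuous_at)
        show "(N has_derivative (*) c) (at u)" using N' by (simp add: has_field_derivative_def c_def)
        show "(*) c \<circ> (*) (inverse c) = id" using \<open>c \<noteq> 0\<close> by (simp add: fun_eq_iff)
      qed (auto simp: M_N)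
      then show ?thesis by (simp add: has_field_derivative_def c_def)
    qed
    have F': "((\<lambda>s. (s - \<alpha>) * \<Psi> (M s)) has_real_derivative \<psi> (\<theta> (N u))) (at (N u))" if "t1 \<le> u" "u \<le> t0" for u
    proof -
      have "((\<lambda>s. \<Psi> (M s)) has_real_derivative
          (lam u * (\<psi> u - \<Psi> u)) * inverse (C * exp (\<Lambda> u - \<Lambda> t0) * lam u)) (at (N u))"
        using \<Psi>[of u] that by (intro DERIV_chain2[OF _ M']) (simp add: M_N)
      moreover have "((\<lambda>s. s - \<alpha>) has_real_derivative 1) (at (N u))"
        by (auto intro!: derivative_eq_intros)
      ultimately have product: "((\<lambda>s. (s - \<alpha>) * \<Psi> (M s)) has_real_derivative
          1 * \<Psi> (M (N u)) + (lam u * (\<psi> u - \<Psi> u)) * inverse (C * exp (\<Lambda> u - \<Lambda> t0) * lam u) * (N u - \<alpha>)) (at (N u))"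
        by (rule DERIV_mult[rotated])
      have quotient: "(lam u * (\<psi> u - \<Psi> u)) * inverse (C * exp (\<Lambda> u - \<Lambda> t0) * lam u) * (N u - \<alpha>) = \<psi> u - \<Psi> u"
      proof -
        define c where "c = C * exp (\<Lambda> u - \<Lambda> t0)"
        have "c \<noteq> 0" "N u - \<alpha> = c" using \<open>0 < C\<close> by (auto simp: c_def N_def)
        then show ?thesis using lam_pos[of u] by (simp add: c_def[symmetric] field_simps)
      qed
      show ?thesis using product that unfolding quotient by (simp add: M_N \<theta>_N)
    qed
    have *: "((\<lambda>s. (s - \<alpha>) * \<Psi> (M s)) has_real_derivative \<psi> (\<theta> s)) (at s)" if s: "s \<in> {N t1..N t}" for s
    proof -
      have "N t \<le> N t0" using N_mono t by (simp add: strict_mono_less_eq)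
      then obtain u where "t1 \<le> u" "u \<le> t0" "s = N u" using N_onto[of s] s by auto
      then show ?thesis using F' by simp
    qed
    have "N t1 \<le> N t" using N_mono t by (simp add: strict_mono_less_eq)
    then have "((\<lambda>s. \<psi> (\<theta> s)) has_integral (N t - \<alpha>) * \<Psi> (M (N t)) - (N t1 - \<alpha>) * \<Psi> (M (N t1))) {N t1..N t}"
      using * by (intro fundamental_theorem_of_calculus)
        (auto simp: has_real_derivative_iff_has_vector_derivative[symmetric] intro: has_field_derivative_at_within)
    then show ?thesis by (simp add: M_N)
  qed
  have up_to_N: "((\<lambda>s. \<psi> (\<theta> s)) has_integral
      (N t - \<alpha>) * \<Psi> t - (N t1 - \<alpha>) * (\<Psi> t1 - (\<psi> t1 - p * (\<psi> t1 - \<psi> a)))) {\<alpha>..N t}"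
    if t: "t1 \<le> t" "t \<le> t0" and \<Psi>: "\<And>t. t \<le> t0 \<Longrightarrow> (\<Psi> has_real_derivative lam t * (\<psi> t - \<Psi> t)) (at t)"
    for t and \<psi> \<Psi> :: "real \<Rightarrow> real"
  proof -
    have "N t1 \<le> N t" using N_mono t by (simp add: strict_mono_less_eq)
    then have "((\<lambda>s. \<psi> (\<theta> s)) has_integral (N t1 - \<alpha>) * (\<psi> t1 - p * (\<psi> t1 - \<psi> a)) +
        ((N t - \<alpha>) * \<Psi> t - (N t1 - \<alpha>) * \<Psi> t1)) {\<alpha>..N t}"
      using chord_part[of \<psi>] main_part[OF t, of \<Psi> \<psi>] \<Psi> N_gt[of t1]
      by (intro has_integral_combine[of \<alpha> "N t1" "N t"]) auto
    then show ?thesis by (simp add: algebra_simps)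
  qed
  have whole: "integral {\<alpha>..b} (\<lambda>s. \<psi> (\<theta> s)) = C * \<Psi> t0 + (b - \<alpha> - C) * \<psi> t0 -
      C * exp (\<Lambda> t1 - \<Lambda> t0) * (\<Psi> t1 - (\<psi> t1 - p * (\<psi> t1 - \<psi> a)))"
    if \<Psi>: "\<And>t. t \<le> t0 \<Longrightarrow> (\<Psi> has_real_derivative lam t * (\<psi> t - \<Psi> t)) (at t)" for \<psi> \<Psi> :: "real \<Rightarrow> real"
  proof -
    have "((\<lambda>s. \<psi> (\<theta> s)) has_integral (b - N t0) *\<^sub>R \<psi> t0) {N t0..b}"
      using assms N_t0 has_integral_const_real[of "\<psi> t0" "N t0" b]
      by (auto simp: \<theta>_t0 intro: has_integral_eq[rotated])
    then have "((\<lambda>s. \<psi> (\<theta> s)) has_integral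
        ((N t0 - \<alpha>) * \<Psi> t0 - (N t1 - \<alpha>) * (\<Psi> t1 - (\<psi> t1 - p * (\<psi> t1 - \<psi> a)))) + (b - N t0) *\<^sub>R \<psi> t0) {\<alpha>..b}"
      using up_to_N[of t0 \<Psi> \<psi>] \<Psi> assms N_t0 N_gt[of t0]
      by (intro has_integral_combine[of \<alpha> "N t0" b]) auto
    then show ?thesis by (simp add: has_integral_iff N_t0 N_t1)
  qed
  have tangent: "integral {\<alpha>..d} (\<lambda>s. above_tangent (\<theta> d) (\<theta> s)) \<le> 0" if d: "\<alpha> < d" for d
  proof -
    have zero: "integral {\<alpha>..N t} (\<lambda>s. above_tangent t (\<theta> s)) = 0" if t: "t1 \<le> t" "t \<le> t0" for t
    proof -
      \<comment> \<open>the companion of the height over a fixed tangent is the same affine functional at \<open>w\<close>\<close>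
      let ?\<Psi> = "\<lambda>r. w2 r - g2 t - \<kappa> t * (w1 r - g1 t)"
      have "(?\<Psi> has_real_derivative lam r * (above_tangent t r - ?\<Psi> r)) (at r)" for r
        unfolding above_tangent_def
        by (auto intro!: derivative_eq_intros DERIV_w1 DERIV_w2 simp: algebra_simps)
      from up_to_N[OF t this]
      have "integral {\<alpha>..N t} (\<lambda>s. above_tangent t (\<theta> s)) = (N t - \<alpha>) * ?\<Psi> t -
          (N t1 - \<alpha>) * (?\<Psi> t1 - (above_tangent t t1 - p * (above_tangent t t1 - above_tangent t a)))"
        by (simp add: has_integral_iff)
      moreover have "?\<Psi> t = 0" using g2_eq[of t] by (simp add: algebra_simps)
      moreover have "above_tangent t t1 - p * (above_tangent t t1 - above_tangent t a) =
          (g2 t1 - p * (g2 t1 - g2 a)) - g2 t - \<kappa> t * ((g1 t1 - p * (g1 t1 - g1 a)) - g1 t)"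
        by (simp add: above_tangent_def algebra_simps)
      ultimately show ?thesis
        using chord_weight(3,4)[of t1] by (simp add: p_def a_def)
    qed
    consider "d \<le> \<sigma>" | "\<sigma> < d" "d \<le> N t1" | "N t1 \<le> d" "d \<le> N t0" | "N t0 < d" by linarith
    then show ?thesis
    proof cases
      case 1
      then have "integral {\<alpha>..d} (\<lambda>s. above_tangent (\<theta> d) (\<theta> s)) = integral {\<alpha>..d} (\<lambda>s. 0)"
        by (intro integral_cong) (auto simp: \<theta>_a above_tangent_def)
      then show ?thesis by simp
    next
      case 2
      have "above_tangent t1 a = 0" using chord_end(3)[of t1] by (simp add: above_tangent_def a_def)
      moreover have "above_tangent t1 t1 = 0" by (simp add: above_tangent_def)
      ultimately have "above_tangent (\<theta> d) (\<theta> s) = 0" if "s \<le> d" for s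
        using 2 that \<theta>_a[of s] \<theta>_t1[of s] \<theta>_t1[of d] by (cases "s \<le> \<sigma>") auto
      then have "integral {\<alpha>..d} (\<lambda>s. above_tangent (\<theta> d) (\<theta> s)) = integral {\<alpha>..d} (\<lambda>s. 0)"
        by (intro integral_cong) auto
      then show ?thesis by simp
    next
      case 3
      then obtain t where "t1 \<le> t" "t \<le> t0" "d = N t" using N_onto by blast
      then show ?thesis using zero \<theta>_N by simp
    next
      case 4
      have "integral {N t0..d} (\<lambda>s. above_tangent t0 (\<theta> s)) = integral {N t0..d} (\<lambda>s. 0)"
        by (intro integral_cong) (auto simp: \<theta>_t0 above_tangent_def)
      moreover have "integral {\<alpha>..N t0} (\<lambda>s. above_tangent t0 (\<theta> s)) + integral {N t0..d} (\<lambda>s. above_tangent t0 (\<theta> s)) =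
          integral {\<alpha>..d} (\<lambda>s. above_tangent t0 (\<theta> s))"
        using 4 N_gt[of t0] d int[OF continuous_on_above_tangent d]
        by (intro Henstock_Kurzweil_Integration.integral_combine) auto
      ultimately show ?thesis using zero[of t0] \<open>t1 < t0\<close> 4 by (simp add: \<theta>_t0)
    qed
  qed
  have "delivery_path t1 t0 C \<alpha> b \<theta>"
    unfolding delivery_path_def a_def[symmetric] p_def[symmetric]
    by (intro conjI allI impI \<open>mono \<theta>\<close> \<theta>_lo \<theta>_hi tangent whole) auto
  then show ?thesis by blast
qed

end

section \<open>Vertical segments in curvilinear triangles\<close>

context tangent_pair
begin

definition triangle_sides :: "real \<Rightarrow> (real \<times> real) set" where
  "triangle_sides t = closed_segment (g1 t, g2 t) (h1 (sL t), h2 (sL t)) \<union>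
     closed_segment (g1 t, g2 t) (w1 t, w2 t) \<union> (\<lambda>s. (h1 s, h2 s)) ` {sR t..sL t}"

lemma in_closed_segment_graph:
  fixes p1 p2 q1 q2 x q :: real
  assumes "p1 \<noteq> q1" "q2 - p2 = q * (q1 - p1)" "x \<in> closed_segment p1 q1"
  shows "(x, p2 + q * (x - p1)) \<in> closed_segment (p1, p2) (q1, q2)"
proof -
  obtain u where u: "0 \<le> u" "u \<le> 1" "x = (1 - u) * p1 + u * q1"
    using assms(3) by (auto simp: in_segment)
  have "p2 + q * (x - p1) = p2 + u * (q * (q1 - p1))" by (simp add: u(3) algebra_simps)
  also have "\<dots> = (1 - u) * p2 + u * q2" unfolding assms(2)[symmetric] by (simp add: algebra_simps)
  finally show ?thesis using u by (auto simp: in_segment)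
qed

text \<open>
  The open region between the two tangents from \<open>g t\<close> and the curve \<open>h\<close> is bounded, and its frontier
  consists of points of the sides.  A connected set that starts in this region and avoids the sides
  cannot leave it, so the region is inside the sides.  The open vertical segment from \<open>g t\<close> up to \<open>h\<close>
  belongs to it.
\<close>

lemma vertical_segment_in_triangle:
  assumes s: "h1 s = g1 t" and y: "g2 t \<le> y" "y \<le> h2 s"
  shows "(g1 t, y) \<in> triangle_sides t \<union> inside (triangle_sides t)"
proof -
  obtain \<xi> where \<xi>: "h1 \<xi> = g1 t" "sR t < \<xi>" "\<xi> < sL t"
    and T: "{s. g2 t - h2 s = m s * (g1 t - h1 s)} = {sR t, sL t}"
    by (rule tangency_on_both_sides)
  have "\<xi> = s" using \<xi> s h.c1_eq_iff[of \<xi> s] by simp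
  then have s_between: "sR t < s" "s < sL t" using \<xi> by auto
  have "sL t \<in> {s. g2 t - h2 s = m s * (g1 t - h1 s)}" unfolding T by simp
  then have gL: "g2 t - h2 (sL t) = m (sL t) * (g1 t - h1 (sL t))" by simp
  define lR where "lR = (\<lambda>x. g2 t + \<kappa> t * (x - g1 t))"
  define lL where "lL = (\<lambda>x. g2 t + m (sL t) * (x - g1 t))"
  have slopes: "\<kappa> t < m (sL t)" using s_between h.strict_mono_k by (simp add: strict_mono_less)
  have lR_le: "lR (h1 u) \<le> h2 u" for u using tangent_below_curve[of t u] by (simp add: lR_def)
  have lL_le: "lL (h1 u) \<le> h2 u" for u
    using h.supporting_line[of "sL t" u] gL by (simp add: lL_def algebra_simps)
  have lR_end: "lR (w1 t) = w2 t" using g2_eq[of t] by (simp add: lR_def algebra_simps)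
  have lL_end: "lL (h1 (sL t)) = h2 (sL t)" using gL by (simp add: lL_def algebra_simps)
  define F where "F = (\<lambda>(u, x2). (h1 u, x2 :: real))"
  define S where "S = {z. sR t < fst z \<and> fst z < sL t \<and> snd z < h2 (fst z) \<and>
     lR (h1 (fst z)) < snd z \<and> lL (h1 (fst z)) < snd z}"
  \<comment> \<open>\<open>F ` S\<close> is the open region; \<open>V\<close> is its closed counterpart, compact as an image of a rectangle\<close>
  define V where "V = (\<lambda>z. (h1 (fst z),
     (1 - snd z) * max (lR (h1 (fst z))) (lL (h1 (fst z))) + snd z * h2 (fst z))) ` ({sR t..sL t} \<times> {0..1})"
  have ch1: "continuous_on UNIV h1" and ch2: "continuous_on UNIV h2"
    using h.isCont_c1 h.isCont_c2 by (auto intro: continuous_at_imp_continuous_on)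
  have cont_fst: "continuous_on X (\<lambda>z. h1 (fst z))" "continuous_on X (\<lambda>z. h2 (fst z))" for X :: "(real \<times> real) set"
    by (intro continuous_on_compose2[OF ch1] continuous_on_compose2[OF ch2] continuous_intros; simp)+
  have "open S"
    unfolding S_def lR_def lL_def
    by (intro open_Collect_conj open_Collect_less continuous_intros cont_fst)
  moreover have "inj_on F S"
    by (auto simp: F_def inj_on_def h.c1_eq_iff)
  moreover have "continuous_on S F"
    unfolding F_def case_prod_unfold by (intro continuous_intros cont_fst)
  \<comment> \<open>\<open>F\<close> replaces the parameter of \<open>h\<close> by the abscissa\<close>
  ultimately have "open (F ` S)" by (intro invariance_of_domain)
  have "compact V"
    unfolding V_def lR_def lL_def
    by (intro compact_continuous_image continuous_intros cont_fst compact_Times) auto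
  have "F ` S \<subseteq> V"
  proof
    fix p assume "p \<in> F ` S"
    then obtain u x2 where p: "p = (h1 u, x2)" and u: "sR t < u" "u < sL t" and x2: "x2 < h2 u" "lR (h1 u) < x2" "lL (h1 u) < x2"
      by (auto simp: F_def S_def)
    define M where "M = max (lR (h1 u)) (lL (h1 u))"
    define \<mu> where "\<mu> = (x2 - M) / (h2 u - M)"
    have M: "M < x2" "x2 < h2 u" using x2 by (auto simp: M_def)
    then have "0 \<le> \<mu>" "\<mu> \<le> 1" by (auto simp: \<mu>_def)
    moreover have "\<mu> * (h2 u - M) = x2 - M" using M by (simp add: \<mu>_def)
    then have "x2 = (1 - \<mu>) * M + \<mu> * h2 u" by (simp add: algebra_simps)
    ultimately show "p \<in> V"
      unfolding V_def p M_def using u by (intro image_eqI[of _ _ "(u, \<mu>)"]) auto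
  qed
  have V_sides: "V - F ` S \<subseteq> triangle_sides t"
  proof
    fix p assume p: "p \<in> V - F ` S"
    then obtain u \<mu> where u: "sR t \<le> u" "u \<le> sL t" and \<mu>: "0 \<le> \<mu>" "\<mu> \<le> 1"
      and p_eq: "p = (h1 u, (1 - \<mu>) * max (lR (h1 u)) (lL (h1 u)) + \<mu> * h2 u)"
      by (auto simp: V_def)
    define M where "M = max (lR (h1 u)) (lL (h1 u))"
    define x2 where "x2 = (1 - \<mu>) * M + \<mu> * h2 u"
    have p': "p = (h1 u, x2)" by (simp add: p_eq x2_def M_def)
    have "M \<le> h2 u" using lR_le lL_le by (simp add: M_def)
    then have "x2 - M = \<mu> * (h2 u - M)" "h2 u - x2 = (1 - \<mu>) * (h2 u - M)" "0 \<le> h2 u - M"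
      by (auto simp: x2_def algebra_simps)
    then have x2: "M \<le> x2" "x2 \<le> h2 u" using \<mu> by (metis diff_ge_0_iff_ge mult_nonneg_nonneg)+
    have "(h1 u, x2) = F (u, x2)" by (simp add: F_def)
    then have "(u, x2) \<notin> S" using p p' by auto
    then consider "x2 = h2 u" | "u = sR t" | "u = sL t" | "x2 = lR (h1 u)" "lL (h1 u) \<le> lR (h1 u)"
      | "x2 = lL (h1 u)" "lR (h1 u) \<le> lL (h1 u)"
      using u x2 by (fastforce simp: S_def M_def max_def split: if_splits)
    then show "p \<in> triangle_sides t"
    proof cases
      case 1
      then show ?thesis using u by (auto simp: p' triangle_sides_def)
    next
      case 2
      then have "x2 = h2 u" using x2 lR_end by (simp add: M_def)
      then show ?thesis using u by (auto simp: p' triangle_sides_def)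
    next
      case 3
      then have "x2 = h2 u" using x2 lL_end by (simp add: M_def)
      then show ?thesis using u by (auto simp: p' triangle_sides_def)
    next
      case 4
      then have "(m (sL t) - \<kappa> t) * (h1 u - g1 t) \<le> 0" by (simp add: lR_def lL_def algebra_simps)
      then have "h1 u \<le> g1 t" using slopes by (simp add: mult_le_0_iff)
      moreover have "w1 t \<le> h1 u" using u by (simp add: h.c1_le_iff)
      ultimately have "h1 u \<in> closed_segment (g1 t) (w1 t)" by (simp add: closed_segment_eq_real_ivl)
      moreover have "w2 t - g2 t = \<kappa> t * (w1 t - g1 t)" using g2_eq[of t] by (simp add: algebra_simps)
      ultimately have "(h1 u, x2) \<in> closed_segment (g1 t, g2 t) (w1 t, w2 t)"
        unfolding 4(1) lR_def using w1_less[of t] by (intro in_closed_segment_graph) auto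
      then show ?thesis by (simp add: p' triangle_sides_def)
    next
      case 5
      then have "0 \<le> (m (sL t) - \<kappa> t) * (h1 u - g1 t)" by (simp add: lR_def lL_def algebra_simps)
      then have "g1 t \<le> h1 u" using slopes by (simp add: zero_le_mult_iff)
      moreover have "h1 u \<le> h1 (sL t)" using u by (simp add: h.c1_le_iff)
      ultimately have "h1 u \<in> closed_segment (g1 t) (h1 (sL t))" by (simp add: closed_segment_eq_real_ivl)
      moreover have "g1 t \<noteq> h1 (sL t)" using s s_between h.c1_eq_iff[of s "sL t"] by simp
      moreover have "h2 (sL t) - g2 t = m (sL t) * (h1 (sL t) - g1 t)" using gL by (simp add: algebra_simps)
      ultimately have "(h1 u, x2) \<in> closed_segment (g1 t, g2 t) (h1 (sL t), h2 (sL t))"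
        unfolding 5(1) lL_def by (intro in_closed_segment_graph) auto
      then show ?thesis by (simp add: p' triangle_sides_def)
    qed
  qed
  have frontier: "frontier (F ` S) \<subseteq> triangle_sides t"
    using \<open>open (F ` S)\<close> V_sides closure_minimal[OF \<open>F ` S \<subseteq> V\<close> compact_imp_closed[OF \<open>compact V\<close>]]
    by (auto simp: frontier_def interior_open)
  consider "(g1 t, y) \<in> triangle_sides t" | "y = g2 t" | "y = h2 s"
    | "(g1 t, y) \<notin> triangle_sides t" "g2 t < y" "y < h2 s"
    using y by fastforce
  then show ?thesis
  proof cases
    case 3
    then show ?thesis using s s_between by (auto simp: triangle_sides_def intro!: image_eqI[of _ _ s])
  next
    case 4
    let ?C = "connected_component_set (- triangle_sides t) (g1 t, y)"
    have "(s, y) \<in> S" using 4 s s_between by (simp add: S_def lR_def lL_def)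
    then have "(g1 t, y) \<in> F ` S" using s by (intro image_eqI[of _ _ "(s, y)"]) (auto simp: F_def)
    moreover have "(g1 t, y) \<in> ?C" using 4 by simp
    moreover have "?C \<inter> frontier (F ` S) = {}"
      using frontier connected_component_subset[of "- triangle_sides t" "(g1 t, y)"] by blast
    ultimately have "?C \<subseteq> F ` S"
      using connected_Int_frontier[of ?C "F ` S"] connected_connected_component by blast
    then have "bounded ?C"
      using \<open>F ` S \<subseteq> V\<close> compact_imp_bounded[OF \<open>compact V\<close>] by (meson bounded_subset order_trans)
    then show ?thesis using 4 by (simp add: inside_def)
  qed (auto simp: triangle_sides_def)
qed

end

section \<open>Families of curves and the memory term\<close>

lemma family_derivatives:
  assumes "C31_family \<epsilon>max G" "e \<in> params \<epsilon>max"
  obtains x y :: "nat \<Rightarrow> real \<Rightarrow> real"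
  where "\<And>t. fst (G e t) = x 0 t" "\<And>t. snd (G e t) = y 0 t"
    and "\<And>i t. i < 3 \<Longrightarrow> (x i has_real_derivative x (Suc i) t) (at t)"
    and "\<And>i t. i < 3 \<Longrightarrow> (y i has_real_derivative y (Suc i) t) (at t)"
    and "\<And>i t. i \<le> 3 \<Longrightarrow> isCont (x i) t" "\<And>i t. i \<le> 3 \<Longrightarrow> isCont (y i) t"
    and "\<And>t. (G e has_vector_derivative (x 1 t, y 1 t)) (at t)"
proof -
  obtain D :: "nat \<Rightarrow> nat \<Rightarrow> real \<Rightarrow> real \<Rightarrow> real \<times> real" where
    D0: "\<forall>\<epsilon>\<in>params \<epsilon>max. \<forall>t. D 0 0 \<epsilon> t = G \<epsilon> t" and
    D': "\<forall>i<3. \<forall>j\<le>1. \<forall>\<epsilon>\<in>params \<epsilon>max. \<forall>t.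
           (D i j \<epsilon> has_vector_derivative D (Suc i) j \<epsilon> t) (at t)" and
    Dc: "\<forall>i\<le>3. \<forall>j\<le>1. continuous_on (params \<epsilon>max \<times> UNIV) (\<lambda>(\<epsilon>, t). D i j \<epsilon> t)"
    using assms(1) unfolding C31_family_def by (elim exE conjE) (rule that)
  define x y where "x = (\<lambda>i t. fst (D i 0 e t))" and "y = (\<lambda>i t. snd (D i 0 e t))"
  have D1: "(D i 0 e has_vector_derivative D (Suc i) 0 e t) (at t)" if "i < 3" for i t
    using D'[rule_format, of i 0 e t] that assms(2) by simp
  have cont: "isCont (D i 0 e) t" if "i \<le> 3" for i t
  proof -
    have "continuous_on UNIV (\<lambda>t. (\<lambda>(\<epsilon>, t). D i 0 \<epsilon> t) (e, t))"
    proof (rule continuous_on_compose2[where g = "\<lambda>(\<epsilon>, t). D i 0 \<epsilon> t" and f = "\<lambda>t. (e, t)"])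
      show "continuous_on (params \<epsilon>max \<times> UNIV) (\<lambda>(\<epsilon>, t). D i 0 \<epsilon> t)" using Dc[rule_format, of i 0] that by simp
      show "continuous_on UNIV (\<lambda>t. (e, t))" by (intro continuous_intros)
    qed (use assms(2) in auto)
    then show ?thesis by (simp add: continuous_on_eq_continuous_at)
  qed
  have G: "G e t = D 0 0 e t" for t using D0[rule_format, OF assms(2)] by (rule sym)
  show thesis
  proof (rule that[of x y])
    show "(x i has_real_derivative x (Suc i) t) (at t)" "(y i has_real_derivative y (Suc i) t) (at t)" if "i < 3" for i t
      using bounded_linear.has_vector_derivative[OF bounded_linear_fst D1[OF that]]
        bounded_linear.has_vector_derivative[OF bounded_linear_snd D1[OF that]]
      by (simp_all add: x_def y_def has_real_derivative_iff_has_vector_derivative)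
    show "isCont (x i) t" "isCont (y i) t" if "i \<le> 3" for i t
      unfolding x_def y_def using cont[OF that] by (intro continuous_intros; simp)+
    show "(G e has_vector_derivative (x 1 t, y 1 t)) (at t)" for t
    proof -
      have "G e = D 0 0 e" using G by (rule ext)
      then show ?thesis using D1[of 0 t] by (simp add: x_def y_def)
    qed
    show "fst (G e t) = x 0 t" "snd (G e t) = y 0 t" for t by (simp_all add: G x_def y_def)
  qed
qed

lemma family_convex_graph:
  assumes "C31_family \<epsilon>max G" "e \<in> params \<epsilon>max" "convex_curve (G e)"
  defines "c1 \<equiv> \<lambda>t. fst (G e t)" and "c2 \<equiv> \<lambda>t. snd (G e t)"
  shows "convex_graph c1 c2 (kappa2 (G e)) (deriv c1) (deriv (kappa2 (G e)))"
    and "deriv c1 differentiable (at t)"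
    and "p \<in> tangent_line (G e) s \<longleftrightarrow> snd p - c2 s = kappa2 (G e) s * (fst p - c1 s)"
proof -
  obtain x y where c: "\<And>t. fst (G e t) = x 0 t" "\<And>t. snd (G e t) = y 0 t"
    and x': "\<And>i t. i < 3 \<Longrightarrow> (x i has_real_derivative x (Suc i) t) (at t)"
    and y': "\<And>i t. i < 3 \<Longrightarrow> (y i has_real_derivative y (Suc i) t) (at t)"
    and cont: "\<And>i t. i \<le> 3 \<Longrightarrow> isCont (x i) t" "\<And>i t. i \<le> 3 \<Longrightarrow> isCont (y i) t"
    and G': "\<And>t. (G e has_vector_derivative (x 1 t, y 1 t)) (at t)"
    using family_derivatives[OF assms(1,2)] by metis
  have c12: "c1 = x 0" "c2 = y 0" using c by (auto simp: c1_def c2_def)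
  have d: "deriv (x 0) = x 1" "deriv (y 0) = y 1" "deriv (x 1) = x 2" "deriv (y 1) = y 2"
    using x'[of 0] y'[of 0] x'[of 1] y'[of 1] by (auto intro!: DERIV_imp_deriv simp: numeral_2_eq_2)
  have pos: "0 < x 1 t" "0 < y 2 t * x 1 t - y 1 t * x 2 t" for t
    using assms(3) unfolding convex_curve_def Let_def c by (auto simp: d simp del: One_nat_def)
  have k: "kappa2 (G e) = (\<lambda>t. y 1 t / x 1 t)" by (auto simp: kappa2_def c d)
  have k': "(kappa2 (G e) has_real_derivative (y 2 t * x 1 t - y 1 t * x 2 t) / (x 1 t * x 1 t)) (at t)" for t
    unfolding k using x'[of 1 t] y'[of 1 t] pos(1)[of t]
    by (auto intro!: derivative_eq_intros simp: numeral_2_eq_2)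
  then have dk: "deriv (kappa2 (G e)) = (\<lambda>t. (y 2 t * x 1 t - y 1 t * x 2 t) / (x 1 t * x 1 t))"
    by (auto intro!: DERIV_imp_deriv)
  show "convex_graph c1 c2 (kappa2 (G e)) (deriv c1) (deriv (kappa2 (G e)))"
  proof
    fix t
    have ne: "x 1 t \<noteq> 0" using pos(1)[of t] by simp
    show "(c1 has_real_derivative deriv c1 t) (at t)" "0 < deriv c1 t"
      using x'[of 0 t] pos by (auto simp: c12 d)
    show "(c2 has_real_derivative kappa2 (G e) t * deriv c1 t) (at t)"
      using y'[of 0 t] ne by (simp add: c12 k d)
    show "(kappa2 (G e) has_real_derivative deriv (kappa2 (G e)) t) (at t)" using k' by (simp add: dk)
    show "0 < deriv (kappa2 (G e)) t" using pos[of t] by (simp add: dk)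
    show "isCont (deriv c1) t" using cont(1)[of 1 t] by (simp add: c12 d)
    show "isCont (deriv (kappa2 (G e))) t"
      unfolding dk using cont(1)[of 1 t] cont(1)[of 2 t] cont(2)[of 1 t] cont(2)[of 2 t] ne
      by (intro continuous_intros) auto
  qed
  show "deriv c1 differentiable (at t)"
    using x'[of 1 t] by (auto simp: c12 d real_differentiable_def)
  have "vector_derivative (G e) (at s) = (x 1 s, y 1 s)" using G' by (rule vector_derivative_at)
  then have "p \<in> tangent_line (G e) s \<longleftrightarrow> (\<exists>u. p = G e s + u *\<^sub>R (x 1 s, y 1 s))"
    by (auto simp: tangent_line_def)
  also have "\<dots> \<longleftrightarrow> (\<exists>u. fst p - c1 s = u * x 1 s \<and> snd p - c2 s = u * y 1 s)"
    by (auto simp: prod_eq_iff c1_def c2_def algebra_simps)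
  also have "\<dots> \<longleftrightarrow> snd p - c2 s = kappa2 (G e) s * (fst p - c1 s)"
    using pos(1)[of s] by (auto simp: k intro!: exI[of _ "(fst p - c1 s) / x 1 s"])
  finally show "p \<in> tangent_line (G e) s \<longleftrightarrow> snd p - c2 s = kappa2 (G e) s * (fst p - c1 s)" .
qed

lemma family_tangent_pair:
  assumes G: "admissible_family \<epsilon>max G" and \<epsilon>: "0 < \<epsilon>" "ereal \<epsilon> < \<epsilon>max"
  shows "tangent_pair (\<lambda>t. fst (G 0 t)) (\<lambda>t. snd (G 0 t)) (kappa2 (G 0)) (deriv (\<lambda>t. fst (G 0 t))) (deriv (kappa2 (G 0)))
      (\<lambda>t. fst (G \<epsilon> t)) (\<lambda>t. snd (G \<epsilon> t)) (kappa2 (G \<epsilon>)) (deriv (\<lambda>t. fst (G \<epsilon> t))) (deriv (kappa2 (G \<epsilon>)))"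
    and "tangency_params G \<epsilon> t =
      {s. snd (G 0 t) - snd (G \<epsilon> s) = kappa2 (G \<epsilon>) s * (fst (G 0 t) - fst (G \<epsilon> s))}"
    and "convex_graph (\<lambda>t. fst (G 0 t)) (\<lambda>t. snd (G 0 t)) (kappa2 (G 0)) (deriv (\<lambda>t. fst (G 0 t))) (deriv (kappa2 (G 0)))"
    and "deriv (\<lambda>t. fst (G 0 t)) differentiable (at t)"
proof -
  have par: "0 \<in> params \<epsilon>max" "\<epsilon> \<in> params \<epsilon>max"
    using G \<epsilon> by (auto simp: params_def admissible_family_def zero_ereal_def)
  have C31: "C31_family \<epsilon>max G" and conv: "convex_curve (G 0)" "convex_curve (G \<epsilon>)"
    and Xi: "Xi G \<epsilon> \<subseteq> Xi G 0"
    and card2: "card (tangency_params G \<epsilon> t) = 2"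
    and second: "s \<in> tangency_params G \<epsilon> t \<Longrightarrow> card (tangent_line (G \<epsilon>) s \<inter> range (G 0)) = 2" for s t
    using G par \<epsilon> unfolding admissible_family_def by simp_all
  note line = family_convex_graph(3)[OF C31 par(2) conv(2)]
  show tan: "tangency_params G \<epsilon> t =
      {s. snd (G 0 t) - snd (G \<epsilon> s) = kappa2 (G \<epsilon>) s * (fst (G 0 t) - fst (G \<epsilon> s))}" for t
    by (simp add: tangency_params_def line)
  show g: "convex_graph (\<lambda>t. fst (G 0 t)) (\<lambda>t. snd (G 0 t)) (kappa2 (G 0)) (deriv (\<lambda>t. fst (G 0 t))) (deriv (kappa2 (G 0)))"
    and "deriv (\<lambda>t. fst (G 0 t)) differentiable (at t)"
    using family_convex_graph(1,2)[OF C31 par(1) conv(1)] by auto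
  show "tangent_pair (\<lambda>t. fst (G 0 t)) (\<lambda>t. snd (G 0 t)) (kappa2 (G 0)) (deriv (\<lambda>t. fst (G 0 t))) (deriv (kappa2 (G 0)))
      (\<lambda>t. fst (G \<epsilon> t)) (\<lambda>t. snd (G \<epsilon> t)) (kappa2 (G \<epsilon>)) (deriv (\<lambda>t. fst (G \<epsilon> t))) (deriv (kappa2 (G \<epsilon>)))"
  proof (intro tangent_pair.intro tangent_pair_axioms.intro)
    show "range (\<lambda>t. fst (G \<epsilon> t)) \<subseteq> range (\<lambda>t. fst (G 0 t))"
    proof safe
      fix t
      have "(fst (G \<epsilon> t), snd (G \<epsilon> t) + 1) \<in> Xi G \<epsilon>" by (force simp: Xi_def)
      then have "(fst (G \<epsilon> t), snd (G \<epsilon> t) + 1) \<in> Xi G 0" using Xi by blast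
      then show "fst (G \<epsilon> t) \<in> range (\<lambda>t. fst (G 0 t))" by (auto simp: Xi_def)
    qed
    show "card {s. snd (G 0 t) - snd (G \<epsilon> s) = kappa2 (G \<epsilon>) s * (fst (G 0 t) - fst (G \<epsilon> s))} = 2" for t
      using card2[of t] by (simp add: tan)
    show "\<exists>r. r \<noteq> t \<and> snd (G 0 r) - snd (G \<epsilon> s) = kappa2 (G \<epsilon>) s * (fst (G 0 r) - fst (G \<epsilon> s))"
      if "snd (G 0 t) - snd (G \<epsilon> s) = kappa2 (G \<epsilon>) s * (fst (G 0 t) - fst (G \<epsilon> s))" for t s
    proof -
      have "s \<in> tangency_params G \<epsilon> t" using that by (simp add: tan)
      then have "card (tangent_line (G \<epsilon>) s \<inter> range (G 0)) = 2" by (rule second)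
      then obtain p q where pq: "tangent_line (G \<epsilon>) s \<inter> range (G 0) = {p, q}" "p \<noteq> q" by (auto simp: card_2_iff)
      then obtain r where "G 0 r \<in> tangent_line (G \<epsilon>) s" "G 0 r \<noteq> G 0 t" by (metis IntE insertCI imageE)
      then show ?thesis by (metis line)
    qed
  qed (use g family_convex_graph(1)[OF C31 par(2) conv(2)] in auto)
qed

text \<open>
  The weight is multiplicative, \<open>exp (R t) * weight t \<tau> = exp (R \<tau>)\<close> for \<open>\<tau> \<le> t\<close>, so \<open>exp (R t)\<close> times
  the memory at \<open>t\<close> is the integral of a function independent of \<open>t\<close> over \<open>{..t}\<close>: the tail of the
  convergent integral over \<open>{..T}\<close>.
\<close>

lemma memory_decay:
  assumes integrable: "stieltjes_integrable (weight_R G \<epsilon> T) (frak_K (G 0) f) {..T}"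
    and R: "\<And>t. (R has_real_derivative rate_R G \<epsilon> t) (at t)"
  shows "((\<lambda>t. exp (R t) * memory_R G \<epsilon> f t) \<longlongrightarrow> 0) at_bot"
proof -
  let ?K = "frak_K (G 0) f"
  have weight: "weight_R G \<epsilon> t \<tau> = exp (R \<tau> - R t)" if "\<tau> \<le> t" for \<tau> t
  proof -
    have "(rate_R G \<epsilon> has_integral R t - R \<tau>) {\<tau>..t}"
      using R that by (intro fundamental_theorem_of_calculus)
        (auto simp: has_real_derivative_iff_has_vector_derivative[symmetric] intro: has_field_derivative_at_within)
    then show ?thesis by (simp add: weight_R_def integral_unique)
  qed
  obtain P N where P: "mono P" "\<forall>a. continuous (at_right a) P" and N: "mono N" "\<forall>a. continuous (at_right a) N"
    and K: "\<forall>a. ?K a = P a - N a"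
    and int: "set_integrable (interval_measure P) {..T} (weight_R G \<epsilon> T)"
      "set_integrable (interval_measure N) {..T} (weight_R G \<epsilon> T)"
    using integrable unfolding stieltjes_integrable_def has_stieltjes_integral_def by blast
  define I where "I = (\<lambda>F t. LINT \<tau>:{..t}|interval_measure F. weight_R G \<epsilon> T \<tau>)"
  have eq: "exp (R t) * memory_R G \<epsilon> f t = exp (R T) * (I P t - I N t)" if "t \<le> T" for t
  proof -
    define c where "c = exp (R T - R t)"
    have w: "weight_R G \<epsilon> t \<tau> = c * weight_R G \<epsilon> T \<tau>" if "\<tau> \<in> {..t}" for \<tau>
      using that \<open>t \<le> T\<close> by (simp add: weight c_def exp_add[symmetric])
    have part: "set_integrable (interval_measure F) {..t} (weight_R G \<epsilon> t)"
      "(LINT \<tau>:{..t}|interval_measure F. weight_R G \<epsilon> t \<tau>) = c * I F t"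
      if F: "set_integrable (interval_measure F) {..T} (weight_R G \<epsilon> T)" for F
    proof -
      have "set_integrable (interval_measure F) {..t} (weight_R G \<epsilon> T)"
        using \<open>t \<le> T\<close> by (intro set_integrable_subset[OF F]) auto
      then have "set_integrable (interval_measure F) {..t} (\<lambda>\<tau>. c * weight_R G \<epsilon> T \<tau>)" by simp
      then show "set_integrable (interval_measure F) {..t} (weight_R G \<epsilon> t)"
        by (subst set_integrable_cong[OF refl refl w])
      have "(LINT \<tau>:{..t}|interval_measure F. weight_R G \<epsilon> t \<tau>) =
          (LINT \<tau>:{..t}|interval_measure F. c * weight_R G \<epsilon> T \<tau>)"
        using w by (intro set_lebesgue_integral_cong) auto
      then show "(LINT \<tau>:{..t}|interval_measure F. weight_R G \<epsilon> t \<tau>) = c * I F t" by (simp add: I_def)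
    qed
    have y: "has_stieltjes_integral (weight_R G \<epsilon> t) ?K {..t} (c * I P t - c * I N t)"
      unfolding has_stieltjes_integral_def
      by (intro exI[of _ P] exI[of _ N] conjI P N K part(1) int) (simp only: part(2) int)
    have "memory_R G \<epsilon> f t = c * I P t - c * I N t"
      unfolding memory_R_def stieltjes_integral_def
    proof (rule some_equality[where P = "has_stieltjes_integral (weight_R G \<epsilon> t) ?K {..t}"])
      show "has_stieltjes_integral (weight_R G \<epsilon> t) ?K {..t} (c * I P t - c * I N t)" by (rule y)
      fix y' assume "has_stieltjes_integral (weight_R G \<epsilon> t) ?K {..t} y'"
      then show "y' = c * I P t - c * I N t"
        using y by (rule has_stieltjes_integral_unique) (simp add: weight_R_def)
    qed
    then show ?thesis by (simp add: c_def exp_diff right_diff_distrib)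
  qed
  have "((\<lambda>t. exp (R T) * (I P t - I N t)) \<longlongrightarrow> exp (R T) * (0 - 0)) at_bot"
    unfolding I_def using int by (intro tendsto_intros set_integral_atMost_tendsto_0)
  moreover have "\<forall>\<^sub>F t in at_bot. exp (R T) * (I P t - I N t) = exp (R t) * memory_R G \<epsilon> f t"
    using eventually_le_at_bot[of T] by eventually_elim (simp only: eq)
  ultimately show ?thesis by (simp add: Lim_transform_eventually)
qed

lemma continuous_antiderivative:
  fixes \<rho> :: "real \<Rightarrow> real"
  assumes "\<And>t. isCont \<rho> t"
  obtains R where "\<And>t. (R has_real_derivative \<rho> t) (at t)"
proof -
  have "\<exists>F. \<forall>t. - \<infinity> < ereal t \<longrightarrow> ereal t < \<infinity> \<longrightarrow> (F has_vector_derivative \<rho> t) (at t)"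
    using assms by (intro einterval_antiderivative) auto
  then show thesis using that by (auto simp: has_real_derivative_iff_has_vector_derivative)
qed

section \<open>Optimizing sequences\<close>

context delivery
begin

text \<open>
  For the point that divides the tangent segment in the proportion \<open>u\<close>, delivery paths are taken with
  an initial part of relative length \<open>u\<close> and started at times that tend to \<open>-\<infinity>\<close>.  At \<open>u = 0\<close>
  there is no initial part, and a constant does.
\<close>

lemma optimizing_parameters:
  assumes "t0 < v" and u: "0 \<le> u" "u \<le> 1" and "\<alpha> < b"
  obtains \<theta> :: "nat \<Rightarrow> real \<Rightarrow> real" and lo :: "nat \<Rightarrow> real"
  where "\<And>n. mono (\<theta> n)" "\<And>n s. lo n \<le> \<theta> n s" "\<And>n s. \<theta> n s \<le> t0"
    and "\<And>n. \<forall>d. \<alpha> < d \<longrightarrow> d \<le> b \<longrightarrow> integral {\<alpha>..d} (\<lambda>s. above_tangent (\<theta> n d) (\<theta> n s)) \<le> 0"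
    and "\<And>n. integral {\<alpha>..b} (\<lambda>s. g1 (\<theta> n s)) = (b - \<alpha>) * ((1 - u) * g1 t0 + u * w1 t0)"
    and "\<And>n. integral {\<alpha>..b} (\<lambda>s. g2 (\<theta> n s)) = (b - \<alpha>) * ((1 - u) * g2 t0 + u * w2 t0)"
    and "(\<lambda>n. integral {\<alpha>..b} (\<lambda>s. f (\<theta> n s))) \<longlonglongrightarrow>
      (b - \<alpha>) * (f t0 + u * (w1 t0 - g1 t0) * candidate_slope t0)"
proof (cases "u = 0")
  case True
  show thesis
    by (rule that[of "\<lambda>_ _. t0" "\<lambda>_. t0"])
      (use True assms in \<open>auto simp: mono_def above_tangent_def\<close>)
next
  case False
  define C where "C = u * (b - \<alpha>)"
  have "C \<le> b - \<alpha>" unfolding C_def using u \<open>\<alpha> < b\<close> by (intro mult_left_le_one_le) auto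
  moreover have "0 < C" using False u \<open>\<alpha> < b\<close> by (simp add: C_def)
  ultimately have C: "0 < C" "\<alpha> + C \<le> b" by simp_all
  define T where "T = (\<lambda>n. t0 - 1 - real n)"
  have "\<exists>\<theta>. delivery_path (T n) t0 C \<alpha> b \<theta>" for n
    using C by (intro delivery_path_exists) (simp_all add: T_def)
  then obtain \<theta> where path: "\<And>n. delivery_path (T n) t0 C \<alpha> b (\<theta> n)" by metis
  have int: "integral {\<alpha>..b} (\<lambda>s. \<psi> (\<theta> n s)) = C * \<Psi> t0 + (b - \<alpha> - C) * \<psi> t0 -
      C * exp (\<Lambda> (T n) - \<Lambda> t0) *
        (\<Psi> (T n) - (\<psi> (T n) - chord_weight (T n) * (\<psi> (T n) - \<psi> (chord_end (T n)))))"
    if "\<And>t. t \<le> t0 \<Longrightarrow> (\<Psi> has_real_derivative lam t * (\<psi> t - \<Psi> t)) (at t)" for n \<psi> \<Psi>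
    using path[of n] that unfolding delivery_path_def by blast
  show thesis
  proof (rule that[of \<theta> "\<lambda>n. chord_end (T n)"])
    show "integral {\<alpha>..b} (\<lambda>s. g1 (\<theta> n s)) = (b - \<alpha>) * ((1 - u) * g1 t0 + u * w1 t0)" for n
      using int[OF DERIV_w1, of n] unfolding chord_weight by (simp add: C_def algebra_simps)
    show "integral {\<alpha>..b} (\<lambda>s. g2 (\<theta> n s)) = (b - \<alpha>) * ((1 - u) * g2 t0 + u * w2 t0)" for n
      using int[OF DERIV_w2, of n] unfolding chord_weight by (simp add: C_def algebra_simps)
    define gap where "gap = (\<lambda>t. candidate_slope t - (f t - f (chord_end t)) / (g1 t - g1 (chord_end t)))"
    define err where "err = (\<lambda>t. exp (\<Lambda> t) * ((g1 t - w1 t) * gap t))"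
    have "filterlim (\<lambda>n. (1 - t0) + real n) at_top sequentially"
      by (rule filterlim_tendsto_add_at_top[OF tendsto_const filterlim_real_sequentially])
    then have "filterlim (\<lambda>n. t0 - 1 - real n) at_bot sequentially"
      by (simp add: filterlim_uminus_at_bot algebra_simps)
    then have "(\<lambda>n. err (T n)) \<longlonglongrightarrow> 0"
      using filterlim_compose[OF chord_error_tendsto_0] by (simp add: err_def gap_def T_def)
    then have "(\<lambda>n. (b - \<alpha>) * (f t0 + u * (w1 t0 - g1 t0) * candidate_slope t0) + C * exp (- \<Lambda> t0) * err (T n)) \<longlonglongrightarrow>
        (b - \<alpha>) * (f t0 + u * (w1 t0 - g1 t0) * candidate_slope t0) + C * exp (- \<Lambda> t0) * 0"
      by (intro tendsto_intros)
    moreover have "integral {\<alpha>..b} (\<lambda>s. f (\<theta> n s)) =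
        (b - \<alpha>) * (f t0 + u * (w1 t0 - g1 t0) * candidate_slope t0) + C * exp (- \<Lambda> t0) * err (T n)" for n
    proof -
      have start: "candidate_at_w t - (f t - chord_weight t * (f t - f (chord_end t))) = - ((g1 t - w1 t) * gap t)" for t
        by (simp add: candidate_at_w_def chord_weight_def gap_def right_diff_distrib algebra_simps)
      have "integral {\<alpha>..b} (\<lambda>s. f (\<theta> n s)) = C * candidate_at_w t0 + (b - \<alpha> - C) * f t0 -
          C * exp (\<Lambda> (T n) - \<Lambda> t0) * - ((g1 (T n) - w1 (T n)) * gap (T n))"
        using int[OF DERIV_candidate_at_w, of n] assms(1) unfolding start by simp
      also have "\<dots> = C * candidate_at_w t0 + (b - \<alpha> - C) * f t0 + C * exp (- \<Lambda> t0) * err (T n)"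
        by (simp add: err_def exp_diff exp_minus field_simps)
      finally have "integral {\<alpha>..b} (\<lambda>s. f (\<theta> n s)) =
          C * candidate_at_w t0 + (b - \<alpha> - C) * f t0 + C * exp (- \<Lambda> t0) * err (T n)" .
      then show ?thesis by (simp add: candidate_at_w_def C_def algebra_simps)
    qed
    ultimately show "(\<lambda>n. integral {\<alpha>..b} (\<lambda>s. f (\<theta> n s))) \<longlonglongrightarrow>
      (b - \<alpha>) * (f t0 + u * (w1 t0 - g1 t0) * candidate_slope t0)" by simp
  qed (use path in \<open>auto simp: delivery_path_def\<close>)
qed

end

theorem theorem5p4p2:
  fixes \<epsilon>max :: ereal
    and G :: "real \<Rightarrow> real \<Rightarrow> real \<times> real"
    and \<epsilon> v :: real
    and f :: "real \<Rightarrow> real"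
    and B :: "real \<times> real \<Rightarrow> real"
    and x :: "real \<times> real"
    and I :: "real set"
  assumes "admissible_family \<epsilon>max G"
    and "0 < \<epsilon>" and "ereal \<epsilon> < \<epsilon>max"
    and "regular_data (G 0) f"
    and "standard_candidate_R G \<epsilon> f v B"
    and "x \<in> Omega_R G \<epsilon> v"
    and "nondegenerate_interval I"
  shows "\<exists>\<phi> :: nat \<Rightarrow> real \<Rightarrow> real \<times> real.
           optimizing_sequence (G 0) (Omega G \<epsilon>) f I B x \<phi> \<and>
           (\<forall>n. nondecreasing_along (G 0) I (\<phi> n)) \<and>
           (\<forall>n. \<forall>s\<in>I. curve_le (G 0) (\<phi> n s) (G 0 v))"
proof -
  define g1 where "g1 = (\<lambda>t. fst (G 0 t))"
  define g2 where "g2 = (\<lambda>t. snd (G 0 t))"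
  define h1 where "h1 = (\<lambda>t. fst (G \<epsilon> t))"
  define h2 where "h2 = (\<lambda>t. snd (G \<epsilon> t))"
  note components = g1_def[symmetric] g2_def[symmetric] h1_def[symmetric] h2_def[symmetric]
  have G0: "G 0 t = (g1 t, g2 t)" and G\<epsilon>: "G \<epsilon> t = (h1 t, h2 t)" for t
    by (simp_all add: g1_def g2_def h1_def h2_def)
  note pair = family_tangent_pair[OF assms(1-3)]
  interpret tp: tangent_pair g1 g2 "kappa2 (G 0)" "deriv g1" "deriv (kappa2 (G 0))"
    h1 h2 "kappa2 (G \<epsilon>)" "deriv h1" "deriv (kappa2 (G \<epsilon>))"
    using pair(1) unfolding components .
  have tangency: "tangency_params G \<epsilon> t = {s. g2 t - h2 s = kappa2 (G \<epsilon>) s * (g1 t - h1 s)}" for t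
    using pair(2)[of t] by (simp add: g1_def g2_def h1_def h2_def)
  have wR: "w_R G \<epsilon> t = (tp.w1 t, tp.w2 t)" for t
    by (simp add: w_R_def tangency tp.sR_def G\<epsilon>)
  have wL: "w_L G \<epsilon> t = (h1 (tp.sL t), h2 (tp.sL t))" for t
    by (simp add: w_L_def tangency tp.sL_def G\<epsilon>)
  have \<kappa>R: "kappa_R G \<epsilon> t = tp.\<kappa> t" for t
  proof -
    have "tp.w2 t - g2 t = tp.\<kappa> t * (tp.w1 t - g1 t)" using tp.g2_eq[of t] by (simp add: algebra_simps)
    then show ?thesis using tp.w1_less[of t] by (simp add: kappa_R_def slope_def wR G0)
  qed
  have sides: "triangle_boundary G \<epsilon> t = tp.triangle_sides t" for t
    unfolding triangle_boundary_def tp.triangle_sides_def S_L_def S_R_def wL wR tangency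
      tp.sR_def[symmetric] tp.sL_def[symmetric] by (simp add: G0 G\<epsilon>)
  have in_Omega: "(g1 r, y) \<in> Omega G \<epsilon>" if "h1 s = g1 r" "g2 r \<le> y" "y \<le> h2 s" for r s y
    using tp.vertical_segment_in_triangle[OF that]
    by (auto simp: Omega_def curvilinear_triangle_def sides)
  have rate: "rate_R G \<epsilon> t = deriv (kappa2 (G 0)) t / (kappa2 (G 0) t - tp.\<kappa> t)" for t
    by (simp add: rate_R_def \<kappa>R)
  have isCont_rate: "isCont (rate_R G \<epsilon>) t" for t
    unfolding rate[abs_def] using tp.\<kappa>_less_k[of t] isCont_o2[OF tp.isCont_sR tp.h.isCont_k]
    by (intro continuous_intros tp.g.isCont_dk tp.g.isCont_k) auto
  obtain R where R: "\<And>t. (R has_real_derivative rate_R G \<epsilon> t) (at t)"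
    using continuous_antiderivative[OF isCont_rate] by blast
  obtain \<Lambda> where \<Lambda>: "\<And>t. (\<Lambda> has_real_derivative tp.lam t) (at t)"
    using continuous_antiderivative[OF tp.isCont_lam] by blast
  note cand = assms(5)[unfolded standard_candidate_R_def]
  have memory: "frak_K (G 0) f t - beta2 G \<epsilon> f t = memory_R G \<epsilon> f t" for t
    by (simp add: beta2_def)
  have "((\<lambda>t. exp (R t) * memory_R G \<epsilon> f t) \<longlongrightarrow> 0) at_bot"
    using cand R by (intro memory_decay[of _ _ "v - 1"]) auto
  moreover obtain f' f'' where f': "\<And>t. (f has_real_derivative f' t) (at t)"
    and f'': "\<And>t. (f' has_real_derivative f'' t) (at t)"
    using assms(4) by (auto simp: regular_data_def C2_function_def)
  have "deriv f = f'" using f' by (auto intro: DERIV_imp_deriv)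
  then have k3: "kappa3 (G 0) f t = f' t / deriv g1 t" for t
    by (simp add: kappa3_def g1_def)
  have "kappa3 (G 0) f differentiable (at t)" for t
  proof -
    have "f' differentiable (at t)" using f'' by (auto simp: real_differentiable_def)
    moreover have "deriv g1 differentiable (at t)" using pair(4)[of t] by (simp add: g1_def)
    ultimately show ?thesis
      unfolding k3[abs_def] using tp.g.d1_pos[of t] by (intro differentiable_divide) auto
  qed
  then have k3': "(kappa3 (G 0) f has_real_derivative deriv (kappa3 (G 0) f) t) (at t)" for t
    by (auto simp: DERIV_deriv_iff_real_differentiable)
  ultimately interpret delivery g1 g2 "kappa2 (G 0)" "deriv g1" "deriv (kappa2 (G 0))"
    h1 h2 "kappa2 (G \<epsilon>)" "deriv h1" "deriv (kappa2 (G \<epsilon>))"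
    \<Lambda> R f "kappa3 (G 0) f" "frak_K (G 0) f" "beta2 G \<epsilon> f" v
  proof unfold_locales
    fix t
    show "(f has_real_derivative kappa3 (G 0) f t * deriv g1 t) (at t)"
      using f'[of t] tp.g.d1_pos[of t] by (simp add: k3)
    show "(kappa3 (G 0) f has_real_derivative frak_K (G 0) f t * deriv (kappa2 (G 0)) t) (at t)"
      using k3'[of t] tp.g.dk_pos[of t] by (simp add: frak_K_def)
    show "(beta2 G \<epsilon> f has_real_derivative deriv (kappa2 (G 0)) t / (kappa2 (G 0) t - tp.\<kappa> t) *
        (frak_K (G 0) f t - beta2 G \<epsilon> f t)) (at t)" if "t < v"
      using cand that unfolding memory rate[symmetric] by blast
  qed (use \<Lambda> R in \<open>auto simp: memory rate\<close>)

  obtain t0 where "t0 < v" and x: "x \<in> S_R G \<epsilon> t0" using assms(6) by (auto simp: Omega_R_def)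
  then obtain u where u: "0 \<le> u" "u \<le> 1"
    and x_eq: "x = ((1 - u) * g1 t0 + u * tp.w1 t0, (1 - u) * g2 t0 + u * tp.w2 t0)"
    by (auto simp: S_R_def in_segment wR G0)
  have "fst x - g1 t0 = u * (tp.w1 t0 - g1 t0)" by (simp add: x_eq algebra_simps)
  then have Bx: "B x = f t0 + u * (tp.w1 t0 - g1 t0) * candidate_slope t0"
    using cand \<open>t0 < v\<close> x by (simp add: candidate_slope_def \<kappa>R G0)
  obtain \<alpha> b where I: "\<alpha> < b" "{\<alpha><..<b} \<subseteq> I" "I \<subseteq> {\<alpha>..b}"
    using assms(7) by (rule nondegenerate_interval_endpoints)
  obtain \<theta> lo where \<theta>: "\<And>n. mono (\<theta> n)" "\<And>n s. lo n \<le> \<theta> n s" "\<And>n s. \<theta> n s \<le> t0"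
    and tangent: "\<And>n. \<forall>d. \<alpha> < d \<longrightarrow> d \<le> b \<longrightarrow> integral {\<alpha>..d} (\<lambda>s. tp.above_tangent (\<theta> n d) (\<theta> n s)) \<le> 0"
    and int_g: "\<And>n. integral {\<alpha>..b} (\<lambda>s. g1 (\<theta> n s)) = (b - \<alpha>) * fst x"
      "\<And>n. integral {\<alpha>..b} (\<lambda>s. g2 (\<theta> n s)) = (b - \<alpha>) * snd x"
    and int_f: "(\<lambda>n. integral {\<alpha>..b} (\<lambda>s. f (\<theta> n s))) \<longlonglongrightarrow> (b - \<alpha>) * B x"
    unfolding Bx unfolding x_eq fst_conv snd_conv
    by (rule optimizing_parameters[OF \<open>t0 < v\<close> u I(1)]) blast
  define \<phi> where "\<phi> = (\<lambda>n s. G 0 (\<theta> n s))"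
  have cont: "continuous_on UNIV g1" "continuous_on UNIV g2" "continuous_on UNIV f"
    using tp.g.isCont_c1 tp.g.isCont_c2 DERIV_isCont[OF DERIV_f] by (auto intro: continuous_at_imp_continuous_on)
  have cont_G: "continuous_on UNIV (G 0)"
    unfolding G0[abs_def] using cont by (intro continuous_intros)
  have average_\<phi>: "average J (\<phi> n) =
      (integral {c..d} (\<lambda>s. g1 (\<theta> n s)) / (d - c), integral {c..d} (\<lambda>s. g2 (\<theta> n s)) / (d - c))"
    if J: "c < d" "{c<..<d} \<subseteq> J" "J \<subseteq> {c..d}" for J c d n
  proof -
    note G_int = average_eq_integral(2,3)[OF cont_G \<theta>(1)[of n] \<theta>(2,3) J]
    have "integral {c..d} (\<lambda>s. G 0 (\<theta> n s)) =
        (integral {c..d} (\<lambda>s. g1 (\<theta> n s)), integral {c..d} (\<lambda>s. g2 (\<theta> n s)))"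
      using integral_linear[OF G_int(1) bounded_linear_fst] integral_linear[OF G_int(1) bounded_linear_snd]
      by (simp add: o_def G0 prod_eq_iff)
    then show ?thesis using G_int(2) by (simp add: \<phi>_def)
  qed
  have inj: "inj (G 0)"
    using tp.g.c1_eq_iff by (auto simp: inj_def G0)
  have f_\<phi>: "on_curve (G 0) f (\<phi> n s) = f (\<theta> n s)" for n s
    by (simp add: on_curve_def \<phi>_def inv_f_f[OF inj])
  have test: "test_function (G 0) (Omega G \<epsilon>) I x (\<phi> n)" for n
    unfolding test_function_def class_A_def
  proof (intro conjI CollectI allI impI)
    show "\<phi> n ` I \<subseteq> range (G 0)" by (auto simp: \<phi>_def)
    show "set_integrable lebesgue I (\<phi> n)"
      unfolding \<phi>_def by (rule average_eq_integral(1)[OF cont_G \<theta>(1-3) I])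
    show "average I (\<phi> n) = x" using I(1) by (simp add: average_\<phi>[OF I] int_g)
    fix J assume J: "nondegenerate_interval J \<and> J \<subseteq> I"
    then obtain c d where cd: "c < d" "{c<..<d} \<subseteq> J" "J \<subseteq> {c..d}"
      using nondegenerate_interval_endpoints by blast
    have "{c<..<d} \<subseteq> {\<alpha>..b}" using cd J I by blast
    then have "\<alpha> \<le> c" "d \<le> b" using cd(1) by (simp_all add: greaterThanLessThan_subseteq_atLeastAtMost_iff)
    obtain r s where
      "integral {c..d} (\<lambda>s. g1 (\<theta> n s)) / (d - c) = g1 r" "h1 s = g1 r"
      "g2 r \<le> integral {c..d} (\<lambda>s. g2 (\<theta> n s)) / (d - c)"
      "integral {c..d} (\<lambda>s. g2 (\<theta> n s)) / (d - c) \<le> h2 s"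
      by (rule tp.average_between_curves[OF \<theta>(1-3) tangent \<open>\<alpha> \<le> c\<close> cd(1) \<open>d \<le> b\<close>])
    then show "average J (\<phi> n) \<in> Omega G \<epsilon>"
      using in_Omega by (simp add: average_\<phi>[OF cd])
  qed
  have "optimizing_sequence (G 0) (Omega G \<epsilon>) f I B x \<phi>"
    unfolding optimizing_sequence_def f_\<phi>
  proof (intro conjI allI test)
    show "set_integrable lebesgue I (\<lambda>s. f (\<theta> n s))" for n
      by (rule average_eq_integral(1)[OF cont(3) \<theta>(1-3) I])
    have "(\<lambda>n. 1 / (b - \<alpha>) * integral {\<alpha>..b} (\<lambda>s. f (\<theta> n s))) \<longlonglongrightarrow> 1 / (b - \<alpha>) * ((b - \<alpha>) * B x)"
      by (intro tendsto_intros int_f)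
    moreover have "average I (\<lambda>s. f (\<theta> n s)) = 1 / (b - \<alpha>) * integral {\<alpha>..b} (\<lambda>s. f (\<theta> n s))" for n
      using average_eq_integral(3)[OF cont(3) \<theta>(1)[of n] \<theta>(2,3) I] by simp
    ultimately show "(\<lambda>n. average I (\<lambda>s. f (\<theta> n s))) \<longlonglongrightarrow> B x" using I(1) by simp
  qed
  moreover have "nondecreasing_along (G 0) I (\<phi> n)" for n
    unfolding nondecreasing_along_def curve_le_def \<phi>_def using \<theta>(1)[of n] by (metis monoD)
  moreover have "curve_le (G 0) (\<phi> n s) (G 0 v)" for n s
    unfolding curve_le_def \<phi>_def using \<theta>(3)[of n s] \<open>t0 < v\<close> by (metis less_imp_le order_trans)
  ultimately show ?thesis by blast
qed

end
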